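(* Let $G$ be an abelian group of finite order $n$ and let $R$ be a commutative ring with identity. Let $\mathbb{V}=RG$ be the group ring, and let $\mathbb{M}=\mathbb{V}G$ be the free $\mathbb{V}$-module with the scalar product $\mathbf{a}\circ X=\mathbf{a}\star X$. Let $\mathbb{T}=M_n(R)G$ be the group ring of $G$ over the matrix ring $M_n(R)\cong\hom_R(\mathbb{V})$. Then $$\mathbb{T}\;\cong\;\hom_{\mathbb{V}}(\mathbb{M})$$ as rings.
   Context: For a ring $S$ with identity, the group ring $SG$ is the set of formal sums $\sum_{g\in G} a_g|g\rangle$ with $a_g\in S$, with componentwise addition and with convolution multiplication $\left(\sum_g a_g|g\rangle\right)\star\left(\sum_h b_h|h\rangle\right)=\sum_k\left(\sum_{gh=k}a_g b_h\right)|k\rangle$. Let $1_G$ be the identity of $G$. Elements of $\mathbb{M}=\mathbb{V}G$ are formal sums $X=\sum_{s\in G}X_s|s\rangle$ with $X_s\in\mathbb{V}=RG$. For $\mathbf{a}=\sum_r \mathbf{a}_r|r\rangle\in\mathbb{V}$ (with $\mathbf{a}_r\in R$) and $X=\sum_s X_s|s\rangle\in\mathbb{M}$, the scalar product making $\mathbb{M}$ a $\mathbb{V}$-module is $$\mathbf{a}\circ X=\mathbf{a}\star X=\sum_{g\in G}\Big(\sum_{rs=g}\mathbf{a}_r\star X_s\Big)|g\rangle,$$ where $\mathbf{a}_r\star X_s$ is the product in $\mathbb{V}$ with $\mathbf{a}_r\in R$ viewed as $\mathbf{a}_r|1_G\rangle\in\mathbb{V}$. For a module $N$ over a ring $S$,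 $\hom_S(N)$ denotes the ring of all $S$-module homomorphisms from $N$ to itself, under pointwise addition and composition of maps. In particular $\hom_{\mathbb{V}}(\mathbb{M})$ is taken with respect to the scalar product $\circ$. *)

theory Defs
  imports "HOL-Algebra.Algebra"
begin

section \<open>Group rings, matrix rings and endomorphism rings\<close>

text \<open>
  A formal sum is its coefficient function, extensional on the carrier of the group. No finite
  support is demanded, so this is the group ring for finite groups only. The coefficient ring
  need not be commutative.
\<close>

definition group_ring :: "('a, 'm) ring_scheme \<Rightarrow> ('g, 'k) monoid_scheme \<Rightarrow> ('g \<Rightarrow> 'a) ring" where
  "group_ring S G = \<lparr>
     carrier = carrier G \<rightarrow>\<^sub>E carrier S,
     monoid.mult = (\<lambda>a b. \<lambda>k\<in>carrier G.
       finsum S (\<lambda>(g, h). a g \<otimes>\<^bsub>S\<^esub> b h)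
         {(g, h). g \<in> carrier G \<and> h \<in> carrier G \<and> g \<otimes>\<^bsub>G\<^esub> h = k}),
     one = (\<lambda>k\<in>carrier G. if k = \<one>\<^bsub>G\<^esub> then \<one>\<^bsub>S\<^esub> else \<zero>\<^bsub>S\<^esub>),
     ring.zero = (\<lambda>k\<in>carrier G. \<zero>\<^bsub>S\<^esub>),
     add = (\<lambda>a b. \<lambda>k\<in>carrier G. a k \<oplus>\<^bsub>S\<^esub> b k)\<rparr>"

definition group_ring_embed ::
  "('a, 'm) ring_scheme \<Rightarrow> ('g, 'k) monoid_scheme \<Rightarrow> 'a \<Rightarrow> 'g \<Rightarrow> 'a" where
  "group_ring_embed S G r = (\<lambda>k\<in>carrier G. if k = \<one>\<^bsub>G\<^esub> then r else \<zero>\<^bsub>S\<^esub>)"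

text \<open>
  The module \<open>(RG)G\<close> over \<open>RG\<close>: a scalar acts through the outer copy of \<open>G\<close>, its
  coefficients being viewed in \<open>RG\<close>; this is not the coefficientwise action of \<open>RG\<close> on \<open>(RG)G\<close>.
\<close>

definition group_ring_module ::
  "('a, 'm) ring_scheme \<Rightarrow> ('g, 'k) monoid_scheme \<Rightarrow> ('g \<Rightarrow> 'a, 'g \<Rightarrow> 'g \<Rightarrow> 'a) module" where
  "group_ring_module R G = ring.extend (group_ring (group_ring R G) G)
     (module.fields (\<lambda>a x. \<lambda>k\<in>carrier G.
       finsum (group_ring R G)
         (\<lambda>(r, s). group_ring_embed R G (a r) \<otimes>\<^bsub>group_ring R G\<^esub> x s)
         {(r, s). r \<in> carrier G \<and> s \<in> carrier G \<and> r \<otimes>\<^bsub>G\<^esub> s = k}))"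

definition matrix_ring :: "nat \<Rightarrow> ('a, 'm) ring_scheme \<Rightarrow> (nat \<times> nat \<Rightarrow> 'a) ring" where
  "matrix_ring n S = \<lparr>
     carrier = {..<n} \<times> {..<n} \<rightarrow>\<^sub>E carrier S,
     monoid.mult = (\<lambda>A B. \<lambda>(i, j)\<in>{..<n} \<times> {..<n}. \<Oplus>\<^bsub>S\<^esub>k\<in>{..<n}. A (i, k) \<otimes>\<^bsub>S\<^esub> B (k, j)),
     one = (\<lambda>(i, j)\<in>{..<n} \<times> {..<n}. if i = j then \<one>\<^bsub>S\<^esub> else \<zero>\<^bsub>S\<^esub>),
     ring.zero = (\<lambda>(i, j)\<in>{..<n} \<times> {..<n}. \<zero>\<^bsub>S\<^esub>),
     add = (\<lambda>A B. \<lambda>(i, j)\<in>{..<n} \<times> {..<n}. A (i, j) \<oplus>\<^bsub>S\<^esub> B (i, j))\<rparr>"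

text \<open>Endomorphisms are extensional, so that equality of maps is equality on the module.\<close>

definition module_end :: "('s, 'k) ring_scheme \<Rightarrow> ('s, 'v, 'm) module_scheme \<Rightarrow> ('v \<Rightarrow> 'v) set" where
  "module_end S N = {f \<in> carrier N \<rightarrow>\<^sub>E carrier N.
     (\<forall>x\<in>carrier N. \<forall>y\<in>carrier N. f (x \<oplus>\<^bsub>N\<^esub> y) = f x \<oplus>\<^bsub>N\<^esub> f y) \<and>
     (\<forall>a\<in>carrier S. \<forall>x\<in>carrier N. f (a \<odot>\<^bsub>N\<^esub> x) = a \<odot>\<^bsub>N\<^esub> f x)}"

definition module_end_ring ::
  "('s, 'k) ring_scheme \<Rightarrow> ('s, 'v, 'm) module_scheme \<Rightarrow> ('v \<Rightarrow> 'v) ring" where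
  "module_end_ring S N = \<lparr>
     carrier = module_end S N,
     monoid.mult = compose (carrier N),
     one = (\<lambda>x\<in>carrier N. x),
     ring.zero = (\<lambda>x\<in>carrier N. \<zero>\<^bsub>N\<^esub>),
     add = (\<lambda>f g. \<lambda>x\<in>carrier N. f x \<oplus>\<^bsub>N\<^esub> g x)\<rparr>"

lemma group_ring_module_simps:
  "carrier (group_ring_module R G) = carrier (group_ring (group_ring R G) G)"
  "monoid.mult (group_ring_module R G) = monoid.mult (group_ring (group_ring R G) G)"
  "one (group_ring_module R G) = one (group_ring (group_ring R G) G)"
  "ring.zero (group_ring_module R G) = ring.zero (group_ring (group_ring R G) G)"
  "add (group_ring_module R G) = add (group_ring (group_ring R G) G)"
  by (simp_all add: group_ring_module_def ring.defs)

lemma (in abelian_monoid) finsum_swap: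
  assumes "finite A" "finite B" "\<And>x y. x \<in> A \<Longrightarrow> y \<in> B \<Longrightarrow> f x y \<in> carrier G"
  shows "(\<Oplus>x\<in>A. \<Oplus>y\<in>B. f x y) = (\<Oplus>y\<in>B. \<Oplus>x\<in>A. f x y)"
  using assms(1,3)
proof (induction A rule: finite_induct)
  case empty
  then show ?case by (simp add: finsum_zero)
next
  case (insert a A)
  have cl: "\<And>x. x \<in> insert a A \<Longrightarrow> (\<Oplus>y\<in>B. f x y) \<in> carrier G"
    using insert.prems by (auto intro!: finsum_closed)
  have cl2: "\<And>y. y \<in> B \<Longrightarrow> (\<Oplus>x\<in>A. f x y) \<in> carrier G"
    using insert.prems by (auto intro!: finsum_closed)
  have "(\<Oplus>y\<in>B. \<Oplus>x\<in>insert a A. f x y) = (\<Oplus>y\<in>B. f a y \<oplus> (\<Oplus>x\<in>A. f x y))"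
  proof (rule finsum_cong')
    show "(\<lambda>y. f a y \<oplus> (\<Oplus>x\<in>A. f x y)) \<in> B \<rightarrow> carrier G" using insert.prems cl2 by auto
    fix y assume "y \<in> B"
    then show "(\<Oplus>x\<in>insert a A. f x y) = f a y \<oplus> (\<Oplus>x\<in>A. f x y)"
      by (intro finsum_insert) (use insert in auto)
  qed simp
  also have "\<dots> = (\<Oplus>y\<in>B. f a y) \<oplus> (\<Oplus>y\<in>B. \<Oplus>x\<in>A. f x y)"
    by (intro finsum_addf) (use insert.prems cl2 in auto)
  also have "(\<Oplus>y\<in>B. \<Oplus>x\<in>A. f x y) = (\<Oplus>x\<in>A. \<Oplus>y\<in>B. f x y)"
    using insert by simp
  also have "(\<Oplus>y\<in>B. f a y) \<oplus> \<dots> = (\<Oplus>x\<in>insert a A. \<Oplus>y\<in>B. f x y)"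
    by (rule finsum_insert[symmetric]) (use insert cl in auto)
  finally show ?case by simp
qed

locale group_ring_setup = S?: ring S + G?: group G
  for S :: "('a, 'm) ring_scheme" (structure) and G :: "('g, 'k) monoid_scheme" (structure) +
  assumes finite_group: "finite (carrier G)"
begin

abbreviation (input) "SG \<equiv> group_ring S G"

lemma SG_mult:
  assumes "a \<in> carrier SG" "b \<in> carrier SG" "k \<in> carrier G"
  shows "(a \<otimes>\<^bsub>SG\<^esub> b) k = (\<Oplus>\<^bsub>S\<^esub>g\<in>carrier G. a g \<otimes>\<^bsub>S\<^esub> b (inv\<^bsub>G\<^esub> g \<otimes>\<^bsub>G\<^esub> k))"
proof -
  let ?P = "{(g, h). g \<in> carrier G \<and> h \<in> carrier G \<and> g \<otimes>\<^bsub>G\<^esub> h = k}"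
  let ?i = "\<lambda>g. (g, inv\<^bsub>G\<^esub> g \<otimes>\<^bsub>G\<^esub> k)"
  have P: "?P = ?i ` carrier G"
    using assms(3) G.inv_solve_left' by (auto simp: G.m_assoc[symmetric] image_iff)
  have "(a \<otimes>\<^bsub>SG\<^esub> b) k = finsum S (\<lambda>(g, h). a g \<otimes>\<^bsub>S\<^esub> b h) (?i ` carrier G)"
    using assms by (simp add: group_ring_def P)
  also have "\<dots> = (\<Oplus>\<^bsub>S\<^esub>g\<in>carrier G. (\<lambda>(g, h). a g \<otimes>\<^bsub>S\<^esub> b h) (?i g))"
    by (rule S.finsum_reindex) (use assms in \<open>auto simp: group_ring_def inj_on_def PiE_iff\<close>)
  finally show ?thesis by simp
qed

lemma SG_mem [simp, intro]: "a \<in> carrier SG \<Longrightarrow> k \<in> carrier G \<Longrightarrow> a k \<in> carrier S"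
  by (auto simp: group_ring_def)

lemma SG_eqI:
  "a \<in> carrier SG \<Longrightarrow> b \<in> carrier SG \<Longrightarrow> (\<And>k. k \<in> carrier G \<Longrightarrow> a k = b k) \<Longrightarrow> a = b"
  by (auto simp: group_ring_def intro: PiE_ext)

lemma SG_add: "k \<in> carrier G \<Longrightarrow> (a \<oplus>\<^bsub>SG\<^esub> b) k = a k \<oplus>\<^bsub>S\<^esub> b k"
  and SG_zero: "k \<in> carrier G \<Longrightarrow> \<zero>\<^bsub>SG\<^esub> k = \<zero>\<^bsub>S\<^esub>"
  and SG_one: "k \<in> carrier G \<Longrightarrow> \<one>\<^bsub>SG\<^esub> k = (if k = \<one>\<^bsub>G\<^esub> then \<one>\<^bsub>S\<^esub> else \<zero>\<^bsub>S\<^esub>)"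
  by (simp_all add: group_ring_def)

lemma SG_mult_closed: "a \<in> carrier SG \<Longrightarrow> b \<in> carrier SG \<Longrightarrow> a \<otimes>\<^bsub>SG\<^esub> b \<in> carrier SG"
  by (auto simp: group_ring_def PiE_iff intro!: S.finsum_closed)

lemma SG_add_closed: "a \<in> carrier SG \<Longrightarrow> b \<in> carrier SG \<Longrightarrow> a \<oplus>\<^bsub>SG\<^esub> b \<in> carrier SG"
  and SG_zero_closed: "\<zero>\<^bsub>SG\<^esub> \<in> carrier SG"
  and SG_one_closed: "\<one>\<^bsub>SG\<^esub> \<in> carrier SG"
  by (auto simp: group_ring_def PiE_iff)

lemma SG_assoc:
  assumes a: "a \<in> carrier SG" and b: "b \<in> carrier SG" and c: "c \<in> carrier SG"
  shows "(a \<otimes>\<^bsub>SG\<^esub> b) \<otimes>\<^bsub>SG\<^esub> c = a \<otimes>\<^bsub>SG\<^esub> (b \<otimes>\<^bsub>SG\<^esub> c)"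
proof (rule SG_eqI)
  fix k assume k: "k \<in> carrier G"
  let ?t = "\<lambda>g h. a g \<otimes>\<^bsub>S\<^esub> (b (inv\<^bsub>G\<^esub> g \<otimes>\<^bsub>G\<^esub> h) \<otimes>\<^bsub>S\<^esub> c (inv\<^bsub>G\<^esub> h \<otimes>\<^bsub>G\<^esub> k))"
  have t: "?t g h \<in> carrier S" if "g \<in> carrier G" "h \<in> carrier G" for g h
    using that a b c k by simp
  have "((a \<otimes>\<^bsub>SG\<^esub> b) \<otimes>\<^bsub>SG\<^esub> c) k =
      (\<Oplus>\<^bsub>S\<^esub>h\<in>carrier G. (a \<otimes>\<^bsub>SG\<^esub> b) h \<otimes>\<^bsub>S\<^esub> c (inv\<^bsub>G\<^esub> h \<otimes>\<^bsub>G\<^esub> k))"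
    by (simp add: SG_mult SG_mult_closed a b c k)
  also have "\<dots> = (\<Oplus>\<^bsub>S\<^esub>h\<in>carrier G. \<Oplus>\<^bsub>S\<^esub>g\<in>carrier G. ?t g h)"
  proof (rule S.finsum_cong')
    fix h assume h: "h \<in> carrier G"
    have "(a \<otimes>\<^bsub>SG\<^esub> b) h \<otimes>\<^bsub>S\<^esub> c (inv\<^bsub>G\<^esub> h \<otimes>\<^bsub>G\<^esub> k) =
      (\<Oplus>\<^bsub>S\<^esub>g\<in>carrier G. a g \<otimes>\<^bsub>S\<^esub> b (inv\<^bsub>G\<^esub> g \<otimes>\<^bsub>G\<^esub> h) \<otimes>\<^bsub>S\<^esub> c (inv\<^bsub>G\<^esub> h \<otimes>\<^bsub>G\<^esub> k))"
      unfolding SG_mult[OF a b h]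
      by (rule S.finsum_ldistr) (use a b c h k finite_group in auto)
    also have "\<dots> = (\<Oplus>\<^bsub>S\<^esub>g\<in>carrier G. ?t g h)"
      by (rule S.finsum_cong') (use a b c h k in \<open>auto simp: S.m_assoc\<close>)
    finally show "(a \<otimes>\<^bsub>SG\<^esub> b) h \<otimes>\<^bsub>S\<^esub> c (inv\<^bsub>G\<^esub> h \<otimes>\<^bsub>G\<^esub> k) = (\<Oplus>\<^bsub>S\<^esub>g\<in>carrier G. ?t g h)" .
  qed (use t in \<open>auto intro!: S.finsum_closed\<close>)
  also have "\<dots> = (\<Oplus>\<^bsub>S\<^esub>g\<in>carrier G. \<Oplus>\<^bsub>S\<^esub>h\<in>carrier G. ?t g h)"
    by (rule S.finsum_swap) (use t finite_group in auto)
  also have "\<dots> = (\<Oplus>\<^bsub>S\<^esub>g\<in>carrier G. a g \<otimes>\<^bsub>S\<^esub> (b \<otimes>\<^bsub>SG\<^esub> c) (inv\<^bsub>G\<^esub> g \<otimes>\<^bsub>G\<^esub> k))"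
  proof (rule S.finsum_cong')
    fix g assume g: "g \<in> carrier G"
    have im: "(\<lambda>h. g \<otimes>\<^bsub>G\<^esub> h) ` carrier G = carrier G"
      using g by (simp add: G.surj_const_mult)
    have "(\<Oplus>\<^bsub>S\<^esub>h\<in>carrier G. ?t g h) = (\<Oplus>\<^bsub>S\<^esub>h\<in>carrier G. ?t g (g \<otimes>\<^bsub>G\<^esub> h))"
      using S.finsum_reindex[of "?t g" "\<lambda>h. g \<otimes>\<^bsub>G\<^esub> h" "carrier G"] g t im
      by (auto simp: G.inj_on_multc inj_on_def)
    also have "\<dots> = (\<Oplus>\<^bsub>S\<^esub>h\<in>carrier G. a g \<otimes>\<^bsub>S\<^esub> (b h \<otimes>\<^bsub>S\<^esub> c (inv\<^bsub>G\<^esub> h \<otimes>\<^bsub>G\<^esub> (inv\<^bsub>G\<^esub> g \<otimes>\<^bsub>G\<^esub> k))))"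
      by (rule S.finsum_cong')
         (use a b c g k in \<open>auto simp: G.m_assoc[symmetric] G.inv_mult_group\<close>)
    also have "\<dots> = a g \<otimes>\<^bsub>S\<^esub> (b \<otimes>\<^bsub>SG\<^esub> c) (inv\<^bsub>G\<^esub> g \<otimes>\<^bsub>G\<^esub> k)"
      unfolding SG_mult[OF b c G.m_closed[OF G.inv_closed[OF g] k]]
      by (rule S.finsum_rdistr[symmetric]) (use a b c g k finite_group in auto)
    finally show "(\<Oplus>\<^bsub>S\<^esub>h\<in>carrier G. ?t g h) = a g \<otimes>\<^bsub>S\<^esub> (b \<otimes>\<^bsub>SG\<^esub> c) (inv\<^bsub>G\<^esub> g \<otimes>\<^bsub>G\<^esub> k)" .
  qed (use a b c k SG_mult_closed in auto)
  also have "\<dots> = (a \<otimes>\<^bsub>SG\<^esub> (b \<otimes>\<^bsub>SG\<^esub> c)) k"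
    by (simp add: SG_mult SG_mult_closed a b c k)
  finally show "((a \<otimes>\<^bsub>SG\<^esub> b) \<otimes>\<^bsub>SG\<^esub> c) k = (a \<otimes>\<^bsub>SG\<^esub> (b \<otimes>\<^bsub>SG\<^esub> c)) k" .
qed (simp_all add: SG_mult_closed a b c)

lemma SG_embed_closed: "x \<in> carrier S \<Longrightarrow> group_ring_embed S G x \<in> carrier SG"
  by (auto simp: group_ring_embed_def group_ring_def PiE_iff)

lemma SG_embed_mult:
  assumes "x \<in> carrier S" "a \<in> carrier SG" "k \<in> carrier G"
  shows "(group_ring_embed S G x \<otimes>\<^bsub>SG\<^esub> a) k = x \<otimes>\<^bsub>S\<^esub> a k"
proof -
  have "(group_ring_embed S G x \<otimes>\<^bsub>SG\<^esub> a) k =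
      (\<Oplus>\<^bsub>S\<^esub>g\<in>carrier G. if \<one>\<^bsub>G\<^esub> = g then x \<otimes>\<^bsub>S\<^esub> a (inv\<^bsub>G\<^esub> g \<otimes>\<^bsub>G\<^esub> k) else \<zero>\<^bsub>S\<^esub>)"
    unfolding SG_mult[OF SG_embed_closed[OF assms(1)] assms(2,3)]
    by (rule S.finsum_cong') (use assms in \<open>auto simp: group_ring_embed_def\<close>)
  also have "\<dots> = x \<otimes>\<^bsub>S\<^esub> a (inv\<^bsub>G\<^esub> \<one>\<^bsub>G\<^esub> \<otimes>\<^bsub>G\<^esub> k)"
    by (rule S.finsum_singleton) (use assms finite_group in auto)
  finally show ?thesis using assms by simp
qed

lemma SG_one_embed: "\<one>\<^bsub>SG\<^esub> = group_ring_embed S G \<one>\<^bsub>S\<^esub>"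
  by (simp add: group_ring_def group_ring_embed_def)

lemma SG_mult_one:
  assumes "a \<in> carrier SG"
  shows "a \<otimes>\<^bsub>SG\<^esub> \<one>\<^bsub>SG\<^esub> = a"
proof (rule SG_eqI)
  fix k assume k: "k \<in> carrier G"
  have "inv\<^bsub>G\<^esub> g \<otimes>\<^bsub>G\<^esub> k = \<one>\<^bsub>G\<^esub> \<longleftrightarrow> k = g" if "g \<in> carrier G" for g
    using that k by (metis G.inv_closed G.inv_equality G.inv_inv G.l_inv)
  then have "(a \<otimes>\<^bsub>SG\<^esub> \<one>\<^bsub>SG\<^esub>) k = (\<Oplus>\<^bsub>S\<^esub>g\<in>carrier G. if k = g then a g else \<zero>\<^bsub>S\<^esub>)"
    unfolding SG_mult[OF assms SG_one_closed k]
    by (intro S.finsum_cong') (use assms k in \<open>auto simp: SG_one\<close>)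
  also have "\<dots> = a k"
    by (rule S.finsum_singleton) (use assms k finite_group in auto)
  finally show "(a \<otimes>\<^bsub>SG\<^esub> \<one>\<^bsub>SG\<^esub>) k = a k" .
qed (simp_all add: SG_mult_closed SG_one_closed assms)

lemma SG_ring: "ring SG"
proof (rule ringI)
  show "abelian_group SG"
  proof (rule abelian_groupI)
    fix x assume x: "x \<in> carrier SG"
    let ?y = "\<lambda>k\<in>carrier G. \<ominus>\<^bsub>S\<^esub> x k"
    have y: "?y \<in> carrier SG" using x by (auto simp: group_ring_def PiE_iff)
    have "?y \<oplus>\<^bsub>SG\<^esub> x = \<zero>\<^bsub>SG\<^esub>"
      by (rule SG_eqI) (use x y in \<open>auto simp: SG_add SG_zero SG_add_closed SG_zero_closed S.l_neg\<close>)
    with y show "\<exists>y\<in>carrier SG. y \<oplus>\<^bsub>SG\<^esub> x = \<zero>\<^bsub>SG\<^esub>" by blast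
  qed (auto intro!: SG_eqI simp: SG_add SG_zero SG_add_closed SG_zero_closed S.a_ac)
  show "monoid SG"
  proof (rule monoidI)
    fix x assume x: "x \<in> carrier SG"
    show "\<one>\<^bsub>SG\<^esub> \<otimes>\<^bsub>SG\<^esub> x = x"
      by (rule SG_eqI) (use x in \<open>auto simp: SG_one_embed SG_embed_mult SG_mult_closed SG_embed_closed\<close>)
  qed (simp_all add: SG_mult_closed SG_one_closed SG_assoc SG_mult_one)
  fix x y z assume xyz: "x \<in> carrier SG" "y \<in> carrier SG" "z \<in> carrier SG"
  show "(x \<oplus>\<^bsub>SG\<^esub> y) \<otimes>\<^bsub>SG\<^esub> z = x \<otimes>\<^bsub>SG\<^esub> z \<oplus>\<^bsub>SG\<^esub> y \<otimes>\<^bsub>SG\<^esub> z"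
  proof (rule SG_eqI)
    fix k assume k: "k \<in> carrier G"
    show "((x \<oplus>\<^bsub>SG\<^esub> y) \<otimes>\<^bsub>SG\<^esub> z) k = (x \<otimes>\<^bsub>SG\<^esub> z \<oplus>\<^bsub>SG\<^esub> y \<otimes>\<^bsub>SG\<^esub> z) k"
      using xyz k
      by (simp add: SG_mult SG_add SG_add_closed S.l_distr S.finsum_addf Pi_def cong: S.finsum_cong)
  qed (simp_all add: xyz SG_mult_closed SG_add_closed)
  show "z \<otimes>\<^bsub>SG\<^esub> (x \<oplus>\<^bsub>SG\<^esub> y) = z \<otimes>\<^bsub>SG\<^esub> x \<oplus>\<^bsub>SG\<^esub> z \<otimes>\<^bsub>SG\<^esub> y"
  proof (rule SG_eqI)
    fix k assume k: "k \<in> carrier G"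
    show "(z \<otimes>\<^bsub>SG\<^esub> (x \<oplus>\<^bsub>SG\<^esub> y)) k = (z \<otimes>\<^bsub>SG\<^esub> x \<oplus>\<^bsub>SG\<^esub> z \<otimes>\<^bsub>SG\<^esub> y) k"
      using xyz k
      by (simp add: SG_mult SG_add SG_add_closed S.r_distr S.finsum_addf Pi_def cong: S.finsum_cong)
  qed (simp_all add: xyz SG_mult_closed SG_add_closed)
qed

end

lemma group_ring_ring:
  assumes "ring S" "group G" "finite (carrier G)"
  shows "ring (group_ring S G)"
  by (rule group_ring_setup.SG_ring)
     (use assms in \<open>simp add: group_ring_setup_def group_ring_setup_axioms_def\<close>)

lemma group_ring_cring:
  assumes "cring R" "comm_group G" "finite (carrier G)"
  shows "cring (group_ring R G)"
proof -
  interpret R: cring R by fact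
  interpret G: comm_group G by fact
  interpret V: group_ring_setup R G by unfold_locales fact
  interpret ring "group_ring R G" by (rule V.SG_ring)
  have "a \<otimes>\<^bsub>group_ring R G\<^esub> b = b \<otimes>\<^bsub>group_ring R G\<^esub> a"
    if a: "a \<in> carrier (group_ring R G)" and b: "b \<in> carrier (group_ring R G)" for a b
  proof (rule V.SG_eqI)
    fix k assume k: "k \<in> carrier G"
    let ?i = "\<lambda>g. inv\<^bsub>G\<^esub> g \<otimes>\<^bsub>G\<^esub> k"
    have ii: "?i (?i g) = g" if "g \<in> carrier G" for g
    proof -
      have "?i (?i g) = (inv\<^bsub>G\<^esub> k \<otimes>\<^bsub>G\<^esub> g) \<otimes>\<^bsub>G\<^esub> k"
        using that k by (simp add: G.inv_mult_group)
      also have "\<dots> = (g \<otimes>\<^bsub>G\<^esub> inv\<^bsub>G\<^esub> k) \<otimes>\<^bsub>G\<^esub> k"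
        using that k by (simp add: G.m_comm)
      also have "\<dots> = g"
        using that k by (simp add: G.m_assoc)
      finally show ?thesis .
    qed
    have inj: "inj_on ?i (carrier G)" using ii by (rule inj_on_inverseI)
    have im: "?i ` carrier G = carrier G"
      
    proof
      show "carrier G \<subseteq> ?i ` carrier G"
      proof
        fix x assume "x \<in> carrier G"
        then show "x \<in> ?i ` carrier G"
          using ii k by (intro image_eqI[of _ _ "?i x"]) simp_all
      qed
    qed (use k in auto)
    have "(a \<otimes>\<^bsub>group_ring R G\<^esub> b) k = (\<Oplus>\<^bsub>R\<^esub>g\<in>?i ` carrier G. a g \<otimes>\<^bsub>R\<^esub> b (?i g))"
      unfolding im by (rule V.SG_mult) fact+
    also have "\<dots> = (\<Oplus>\<^bsub>R\<^esub>g\<in>carrier G. a (?i g) \<otimes>\<^bsub>R\<^esub> b (?i (?i g)))"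
      by (rule R.finsum_reindex[OF _ inj]) (use a b k in auto)
    also have "\<dots> = (\<Oplus>\<^bsub>R\<^esub>g\<in>carrier G. b g \<otimes>\<^bsub>R\<^esub> a (?i g))"
      by (rule R.finsum_cong') (use a b k in \<open>auto simp: ii R.m_comm\<close>)
    also have "\<dots> = (b \<otimes>\<^bsub>group_ring R G\<^esub> a) k"
      by (rule V.SG_mult[symmetric]) fact+
    finally show "(a \<otimes>\<^bsub>group_ring R G\<^esub> b) k = (b \<otimes>\<^bsub>group_ring R G\<^esub> a) k" .
  qed (simp_all add: V.SG_mult_closed a b)
  then show ?thesis by unfold_locales
qed

lemma group_ring_module_module:
  assumes "cring R" "comm_group G" "finite (carrier G)"
  shows "module (group_ring R G) (group_ring_module R G)"
proof -
  interpret R: cring R by fact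
  interpret G: comm_group G by fact
  interpret V: group_ring_setup R G by unfold_locales fact
  interpret VR: cring "group_ring R G" by (rule group_ring_cring) fact+
  interpret M: group_ring_setup "group_ring R G" G by unfold_locales fact
  let ?V = "group_ring R G" and ?M = "group_ring (group_ring R G) G"
  let ?N = "group_ring_module R G"
  interpret MR: ring ?M by (rule M.SG_ring)
  define e where "e = (\<lambda>r. group_ring_embed R G r)"
  define E where "E = (\<lambda>a. \<lambda>g\<in>carrier G. e (a g))"
  have e_cl: "e r \<in> carrier ?V" if "r \<in> carrier R" for r
    using that by (simp add: e_def V.SG_embed_closed)
  have e_at: "e r k = (if k = \<one>\<^bsub>G\<^esub> then r else \<zero>\<^bsub>R\<^esub>)" if "k \<in> carrier G" for r k
    using that by (simp add: e_def group_ring_embed_def)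
  have e_hom: "e \<in> ring_hom R ?V"
  proof (rule ring_hom_memI)
    fix x y assume x: "x \<in> carrier R" and y: "y \<in> carrier R"
    show "e (x \<otimes>\<^bsub>R\<^esub> y) = e x \<otimes>\<^bsub>?V\<^esub> e y"
    proof (rule V.SG_eqI)
      fix k assume "k \<in> carrier G"
      then show "e (x \<otimes>\<^bsub>R\<^esub> y) k = (e x \<otimes>\<^bsub>?V\<^esub> e y) k"
        using x y V.SG_embed_mult[OF x e_cl[OF y], of k, folded e_def] by (simp add: e_at)
    qed (use x y in \<open>simp_all add: e_cl\<close>)
    show "e (x \<oplus>\<^bsub>R\<^esub> y) = e x \<oplus>\<^bsub>?V\<^esub> e y"
      by (rule V.SG_eqI) (use x y in \<open>simp_all add: e_cl e_at V.SG_add\<close>)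
  qed (simp_all add: e_cl V.SG_one_embed flip: e_def)
  interpret e: ring_hom_cring R ?V e by unfold_locales (rule e_hom)
  have E_cl: "E a \<in> carrier ?M" if "a \<in> carrier ?V" for a
    using that by (auto simp: E_def group_ring_def[of ?V] PiE_iff intro!: e_cl)
  have E_at: "E a k = e (a k)" if "k \<in> carrier G" for a k
    using that by (simp add: E_def)
  have E_mult: "E (a \<otimes>\<^bsub>?V\<^esub> b) = E a \<otimes>\<^bsub>?M\<^esub> E b" if a: "a \<in> carrier ?V" and b: "b \<in> carrier ?V" for a b
  proof (rule M.SG_eqI)
    fix k assume k: "k \<in> carrier G"
    have "E (a \<otimes>\<^bsub>?V\<^esub> b) k = (\<Oplus>\<^bsub>?V\<^esub>g\<in>carrier G. e (a g \<otimes>\<^bsub>R\<^esub> b (inv\<^bsub>G\<^esub> g \<otimes>\<^bsub>G\<^esub> k)))"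
      using k a b by (simp add: E_at V.SG_mult e.hom_finsum comp_def Pi_def del: e.hom_mult)
    also have "\<dots> = (\<Oplus>\<^bsub>?V\<^esub>g\<in>carrier G. E a g \<otimes>\<^bsub>?V\<^esub> E b (inv\<^bsub>G\<^esub> g \<otimes>\<^bsub>G\<^esub> k))"
      by (rule VR.finsum_cong') (use a b k in \<open>auto simp: E_at\<close>)
    also have "\<dots> = (E a \<otimes>\<^bsub>?M\<^esub> E b) k"
      by (rule M.SG_mult[symmetric]) (use a b k E_cl in auto)
    finally show "E (a \<otimes>\<^bsub>?V\<^esub> b) k = (E a \<otimes>\<^bsub>?M\<^esub> E b) k" .
  qed (use a b in \<open>simp_all add: E_cl\<close>)
  have E_add: "E (a \<oplus>\<^bsub>?V\<^esub> b) = E a \<oplus>\<^bsub>?M\<^esub> E b" if a: "a \<in> carrier ?V" and b: "b \<in> carrier ?V" for a b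
    by (rule M.SG_eqI) (use a b in \<open>simp_all add: E_cl E_at V.SG_add M.SG_add\<close>)
  have E_one: "E \<one>\<^bsub>?V\<^esub> = \<one>\<^bsub>?M\<^esub>"
  proof (rule M.SG_eqI)
    fix k assume "k \<in> carrier G"
    then show "E \<one>\<^bsub>?V\<^esub> k = \<one>\<^bsub>?M\<^esub> k"
      using e.hom_one e.hom_zero by (simp add: E_at V.SG_one M.SG_one)
  qed (simp_all add: E_cl)
  have smult: "a \<odot>\<^bsub>?N\<^esub> Y = E a \<otimes>\<^bsub>?M\<^esub> Y"
    if a: "a \<in> carrier ?V" and Y: "Y \<in> carrier ?M" for a Y
  proof
    fix k
    let ?P = "{(r, s). r \<in> carrier G \<and> s \<in> carrier G \<and> r \<otimes>\<^bsub>G\<^esub> s = k}"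
    have "finsum ?V (\<lambda>(r, s). e (a r) \<otimes>\<^bsub>?V\<^esub> Y s) ?P = finsum ?V (\<lambda>(r, s). E a r \<otimes>\<^bsub>?V\<^esub> Y s) ?P"
      by (rule VR.finsum_cong') (use a Y E_cl in \<open>auto simp: E_at\<close>)
    then show "(a \<odot>\<^bsub>?N\<^esub> Y) k = (E a \<otimes>\<^bsub>?M\<^esub> Y) k"
      by (simp add: group_ring_module_def ring.defs module.defs group_ring_def[of ?V] e_def)
  qed
  have N: "abelian_group ?N"
    by (rule abelian_groupI)
       (auto simp: group_ring_module_simps MR.a_assoc intro: MR.a_comm MR.l_neg
          bexI[of _ "\<ominus>\<^bsub>?M\<^esub> _"])
  show ?thesis
    by (rule moduleI)
       (use N in \<open>simp_all add: group_ring_module_simps smult E_cl E_mult E_add E_one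
          VR.cring_axioms MR.l_distr MR.r_distr MR.m_assoc\<close>)
qed

lemma matrix_ring_ring:
  assumes "ring S"
  shows "ring (matrix_ring n S)"
proof -
  interpret S: ring S by fact
  let ?M = "matrix_ring n S"
  have mem [simp, intro]: "A (i, j) \<in> carrier S" if "A \<in> carrier ?M" "i < n" "j < n" for A i j
    using that by (auto simp: matrix_ring_def)
  have eqI: "A = B" if "A \<in> carrier ?M" "B \<in> carrier ?M"
    "\<And>i j. i < n \<Longrightarrow> j < n \<Longrightarrow> A (i, j) = B (i, j)" for A B
    using that unfolding matrix_ring_def
    by (intro PiE_ext[of A "{..<n} \<times> {..<n}" "\<lambda>_. carrier S" B]) auto
  have at: "(A \<oplus>\<^bsub>?M\<^esub> B) (i, j) = A (i, j) \<oplus>\<^bsub>S\<^esub> B (i, j)" "\<zero>\<^bsub>?M\<^esub> (i, j) = \<zero>\<^bsub>S\<^esub>"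
    "\<one>\<^bsub>?M\<^esub> (i, j) = (if i = j then \<one>\<^bsub>S\<^esub> else \<zero>\<^bsub>S\<^esub>)"
    "(A \<otimes>\<^bsub>?M\<^esub> B) (i, j) = (\<Oplus>\<^bsub>S\<^esub>k\<in>{..<n}. A (i, k) \<otimes>\<^bsub>S\<^esub> B (k, j))"
    if "i < n" "j < n" for A B i j
    using that by (simp_all add: matrix_ring_def)
  have cl: "A \<oplus>\<^bsub>?M\<^esub> B \<in> carrier ?M" "A \<otimes>\<^bsub>?M\<^esub> B \<in> carrier ?M"
    if "A \<in> carrier ?M" "B \<in> carrier ?M" for A B
    using that by (auto simp: matrix_ring_def PiE_iff intro!: S.finsum_closed)
  have cl0: "\<zero>\<^bsub>?M\<^esub> \<in> carrier ?M" "\<one>\<^bsub>?M\<^esub> \<in> carrier ?M"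
    by (auto simp: matrix_ring_def PiE_iff)
  show ?thesis
  proof (rule ringI)
    show "abelian_group ?M"
    proof (rule abelian_groupI)
      fix A assume A: "A \<in> carrier ?M"
      let ?B = "\<lambda>(i, j)\<in>{..<n} \<times> {..<n}. \<ominus>\<^bsub>S\<^esub> A (i, j)"
      have B: "?B \<in> carrier ?M" using A by (auto simp: matrix_ring_def PiE_iff)
      have "?B \<oplus>\<^bsub>?M\<^esub> A = \<zero>\<^bsub>?M\<^esub>"
        by (rule eqI) (use A B in \<open>auto simp: at cl cl0 S.l_neg\<close>)
      with B show "\<exists>B\<in>carrier ?M. B \<oplus>\<^bsub>?M\<^esub> A = \<zero>\<^bsub>?M\<^esub>" by blast
    qed (auto intro!: eqI simp: at cl cl0 S.a_ac)
    show "monoid ?M"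
    proof (rule monoidI)
      fix A assume A: "A \<in> carrier ?M"
      show "\<one>\<^bsub>?M\<^esub> \<otimes>\<^bsub>?M\<^esub> A = A"
      proof (rule eqI)
        fix i j assume ij: "i < n" "j < n"
        have "(\<one>\<^bsub>?M\<^esub> \<otimes>\<^bsub>?M\<^esub> A) (i, j) = (\<Oplus>\<^bsub>S\<^esub>k\<in>{..<n}. if i = k then A (k, j) else \<zero>\<^bsub>S\<^esub>)"
          unfolding at(4)[OF ij] by (rule S.finsum_cong') (use A ij in \<open>auto simp: at\<close>)
        also have "\<dots> = A (i, j)"
          by (rule S.finsum_singleton) (use A ij in auto)
        finally show "(\<one>\<^bsub>?M\<^esub> \<otimes>\<^bsub>?M\<^esub> A) (i, j) = A (i, j)" .
      qed (simp_all add: A cl cl0)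
      show "A \<otimes>\<^bsub>?M\<^esub> \<one>\<^bsub>?M\<^esub> = A"
      proof (rule eqI)
        fix i j assume ij: "i < n" "j < n"
        have "(A \<otimes>\<^bsub>?M\<^esub> \<one>\<^bsub>?M\<^esub>) (i, j) = (\<Oplus>\<^bsub>S\<^esub>k\<in>{..<n}. if j = k then A (i, k) else \<zero>\<^bsub>S\<^esub>)"
          unfolding at(4)[OF ij] by (rule S.finsum_cong') (use A ij in \<open>auto simp: at\<close>)
        also have "\<dots> = A (i, j)"
          by (rule S.finsum_singleton) (use A ij in auto)
        finally show "(A \<otimes>\<^bsub>?M\<^esub> \<one>\<^bsub>?M\<^esub>) (i, j) = A (i, j)" .
      qed (simp_all add: A cl cl0)
    next
      fix A B C assume ABC: "A \<in> carrier ?M" "B \<in> carrier ?M" "C \<in> carrier ?M"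
      show "A \<otimes>\<^bsub>?M\<^esub> B \<otimes>\<^bsub>?M\<^esub> C = A \<otimes>\<^bsub>?M\<^esub> (B \<otimes>\<^bsub>?M\<^esub> C)"
      proof (rule eqI)
        fix i j assume ij: "i < n" "j < n"
        let ?t = "\<lambda>k l. A (i, l) \<otimes>\<^bsub>S\<^esub> (B (l, k) \<otimes>\<^bsub>S\<^esub> C (k, j))"
        have t: "?t k l \<in> carrier S" if "k < n" "l < n" for k l using that ABC ij by simp
        have "(A \<otimes>\<^bsub>?M\<^esub> B \<otimes>\<^bsub>?M\<^esub> C) (i, j) = (\<Oplus>\<^bsub>S\<^esub>k\<in>{..<n}. \<Oplus>\<^bsub>S\<^esub>l\<in>{..<n}. ?t k l)"
          unfolding at(4)[OF ij]
        proof (rule S.finsum_cong')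
          fix k assume k: "k \<in> {..<n}"
          have "(A \<otimes>\<^bsub>?M\<^esub> B) (i, k) \<otimes>\<^bsub>S\<^esub> C (k, j) =
              (\<Oplus>\<^bsub>S\<^esub>l\<in>{..<n}. A (i, l) \<otimes>\<^bsub>S\<^esub> B (l, k) \<otimes>\<^bsub>S\<^esub> C (k, j))"
            using k ij ABC by (simp add: at S.finsum_ldistr Pi_def)
          also have "\<dots> = (\<Oplus>\<^bsub>S\<^esub>l\<in>{..<n}. ?t k l)"
            by (rule S.finsum_cong') (use k ij ABC in \<open>auto simp: S.m_assoc\<close>)
          finally show "(A \<otimes>\<^bsub>?M\<^esub> B) (i, k) \<otimes>\<^bsub>S\<^esub> C (k, j) = (\<Oplus>\<^bsub>S\<^esub>l\<in>{..<n}. ?t k l)" .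
        qed (use t in \<open>auto intro!: S.finsum_closed\<close>)
        also have "\<dots> = (\<Oplus>\<^bsub>S\<^esub>l\<in>{..<n}. \<Oplus>\<^bsub>S\<^esub>k\<in>{..<n}. ?t k l)"
          by (rule S.finsum_swap) (use t in auto)
        also have "\<dots> = (A \<otimes>\<^bsub>?M\<^esub> (B \<otimes>\<^bsub>?M\<^esub> C)) (i, j)"
          unfolding at(4)[OF ij]
        proof (rule S.finsum_cong')
          fix l assume l: "l \<in> {..<n}"
          show "(\<Oplus>\<^bsub>S\<^esub>k\<in>{..<n}. ?t k l) = A (i, l) \<otimes>\<^bsub>S\<^esub> (B \<otimes>\<^bsub>?M\<^esub> C) (l, j)"
            using l ij ABC by (simp add: at S.finsum_rdistr Pi_def)
        qed (use ABC ij cl in auto)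
        finally show "(A \<otimes>\<^bsub>?M\<^esub> B \<otimes>\<^bsub>?M\<^esub> C) (i, j) = (A \<otimes>\<^bsub>?M\<^esub> (B \<otimes>\<^bsub>?M\<^esub> C)) (i, j)" .
      qed (simp_all add: ABC cl)
    qed (simp_all add: cl cl0)
    fix A B C assume ABC: "A \<in> carrier ?M" "B \<in> carrier ?M" "C \<in> carrier ?M"
    show "(A \<oplus>\<^bsub>?M\<^esub> B) \<otimes>\<^bsub>?M\<^esub> C = A \<otimes>\<^bsub>?M\<^esub> C \<oplus>\<^bsub>?M\<^esub> B \<otimes>\<^bsub>?M\<^esub> C"
      by (rule eqI) (use ABC in \<open>simp_all add: cl at S.l_distr S.finsum_addf Pi_def cong: S.finsum_cong\<close>)
    show "C \<otimes>\<^bsub>?M\<^esub> (A \<oplus>\<^bsub>?M\<^esub> B) = C \<otimes>\<^bsub>?M\<^esub> A \<oplus>\<^bsub>?M\<^esub> C \<otimes>\<^bsub>?M\<^esub> B"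
      by (rule eqI) (use ABC in \<open>simp_all add: cl at S.r_distr S.finsum_addf Pi_def cong: S.finsum_cong\<close>)
  qed
qed

lemma (in module) module_end_ring_ring: "ring (module_end_ring R M)"
proof -
  let ?E = "module_end_ring R M"
  have E: "f \<in> carrier ?E \<longleftrightarrow> f \<in> carrier M \<rightarrow>\<^sub>E carrier M \<and>
      (\<forall>x\<in>carrier M. \<forall>y\<in>carrier M. f (x \<oplus>\<^bsub>M\<^esub> y) = f x \<oplus>\<^bsub>M\<^esub> f y) \<and>
      (\<forall>a\<in>carrier R. \<forall>x\<in>carrier M. f (a \<odot>\<^bsub>M\<^esub> x) = a \<odot>\<^bsub>M\<^esub> f x)" for f
    by (simp add: module_end_ring_def module_end_def)
  have mem [simp]: "f x \<in> carrier M" if "f \<in> carrier ?E" "x \<in> carrier M" for f x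
    using that by (auto simp: E)
  have hom: "f (x \<oplus>\<^bsub>M\<^esub> y) = f x \<oplus>\<^bsub>M\<^esub> f y" if "f \<in> carrier ?E" "x \<in> carrier M" "y \<in> carrier M" for f x y
    using that by (auto simp: E)
  have eqI: "f = g" if "f \<in> carrier ?E" "g \<in> carrier ?E" "\<And>x. x \<in> carrier M \<Longrightarrow> f x = g x" for f g
    using that unfolding E by (intro PiE_ext[of f "carrier M" "\<lambda>_. carrier M" g]) auto
  have at: "(f \<oplus>\<^bsub>?E\<^esub> g) x = f x \<oplus>\<^bsub>M\<^esub> g x" "(f \<otimes>\<^bsub>?E\<^esub> g) x = f (g x)" "\<one>\<^bsub>?E\<^esub> x = x" "\<zero>\<^bsub>?E\<^esub> x = \<zero>\<^bsub>M\<^esub>"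
    if "x \<in> carrier M" for f g x
    using that by (simp_all add: module_end_ring_def compose_def)
  have ext: "f \<oplus>\<^bsub>?E\<^esub> g \<in> extensional (carrier M)" "f \<otimes>\<^bsub>?E\<^esub> g \<in> extensional (carrier M)"
    "\<one>\<^bsub>?E\<^esub> \<in> extensional (carrier M)" "\<zero>\<^bsub>?E\<^esub> \<in> extensional (carrier M)" for f g
    by (simp_all add: module_end_ring_def compose_def)
  have cl: "f \<oplus>\<^bsub>?E\<^esub> g \<in> carrier ?E" "f \<otimes>\<^bsub>?E\<^esub> g \<in> carrier ?E"
    if "f \<in> carrier ?E" "g \<in> carrier ?E" for f g
    using that ext unfolding E PiE_iff by (auto simp: at smult_r_distr M.a_ac)
  have cl0: "\<one>\<^bsub>?E\<^esub> \<in> carrier ?E" "\<zero>\<^bsub>?E\<^esub> \<in> carrier ?E"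
    using ext unfolding E PiE_iff by (auto simp: at)
  show ?thesis
  proof (rule ringI)
    show "abelian_group ?E"
    proof (rule abelian_groupI)
      fix f assume f: "f \<in> carrier ?E"
      let ?g = "\<lambda>x\<in>carrier M. \<ominus>\<^bsub>M\<^esub> f x"
      have g: "?g \<in> carrier ?E"
        using f unfolding E PiE_iff by (auto simp: M.minus_add smult_r_minus)
      have "?g \<oplus>\<^bsub>?E\<^esub> f = \<zero>\<^bsub>?E\<^esub>"
        by (rule eqI) (use f g in \<open>auto simp: at cl cl0 M.l_neg\<close>)
      with g show "\<exists>g\<in>carrier ?E. g \<oplus>\<^bsub>?E\<^esub> f = \<zero>\<^bsub>?E\<^esub>" by blast
    qed (auto intro!: eqI simp: at cl cl0 M.a_ac)
    show "monoid ?E"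
      by (rule monoidI) (auto intro!: eqI simp: at cl cl0)
  qed (auto intro!: eqI simp: at cl hom)
qed

end

theory Submission
  imports Defs
begin

text \<open>
  The isomorphism is a composite \<open>M\<^sub>n(R)G \<simeq> End\<^sub>R(V)G \<simeq> End\<^sub>V(VG)\<close>, in which \<open>V = RG\<close> enters the
  middle term only as the free \<open>R\<close>-module on the \<open>n\<close> elements of \<open>G\<close>.

  The first step enumerates \<open>G\<close>, turns a matrix into the linear map of that basis
  (\<open>matrix_ring_iso_End\<close>), and applies this ring isomorphism to every coefficient of a formal
  sum (\<open>group_ring_iso_cong\<close>).

  The second step holds with any \<open>R\<close>-module \<open>N\<close> in place of \<open>V\<close>. A sum \<open>\<Sum> T\<^sub>g|g\<rangle>\<close> of endomorphisms of
  \<open>N\<close> acts on \<open>NG\<close> by convolution, \<open>T\<^sub>g|g\<rangle> \<cdot> x|s\<rangle> = T\<^sub>g(x)|gs\<rangle>\<close>. A scalar \<open>r|h\<rangle>\<close> of \<open>RG\<close> sends \<open>x|s\<rangle>\<close> to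
  \<open>rx|hs\<rangle>\<close>, so the two actions commute because \<open>T\<^sub>g\<close> is linear and \<open>G\<close> is abelian. No other
  \<open>RG\<close>-linear map exists: since \<open>x|s\<rangle> = |s\<rangle> \<cdot> x|1\<rangle>\<close>, such a map \<open>\<phi>\<close> is determined by the elements
  \<open>\<phi>(x|1\<rangle>) = \<Sum> T\<^sub>g(x)|g\<rangle>\<close>, and linearity of \<open>\<phi>\<close> makes each \<open>T\<^sub>g\<close> linear over \<open>R\<close>
  (\<open>components_closed\<close>, \<open>convolve_components\<close>). The scalar product of the theorem, which lets
  \<open>RG\<close> act through the outer copy of \<open>G\<close>, is an instance of this with \<open>N = V\<close>
  (\<open>group_ring_module_convolution\<close>).
\<close>

section \<open>Additive maps and finite sums\<close>

text \<open>
  Besides ring homomorphisms, this covers evaluation of a function at a point, an endomorphism of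
  a module, and the identity between two structures that share their additive group.
\<close>

lemma additive_finsum:
  assumes "abelian_group A" "abelian_group B"
    and f: "f \<in> carrier A \<rightarrow> carrier B"
    and add: "\<And>x y. x \<in> carrier A \<Longrightarrow> y \<in> carrier A \<Longrightarrow> f (x \<oplus>\<^bsub>A\<^esub> y) = f x \<oplus>\<^bsub>B\<^esub> f y"
    and x: "\<And>i. i \<in> I \<Longrightarrow> x i \<in> carrier A"
  shows "f (\<Oplus>\<^bsub>A\<^esub>i\<in>I. x i) = (\<Oplus>\<^bsub>B\<^esub>i\<in>I. f (x i))"
proof -
  interpret A: abelian_group A by fact
  interpret B: abelian_group B by fact
  have f_zero: "f \<zero>\<^bsub>A\<^esub> = \<zero>\<^bsub>B\<^esub>"
    using add[of "\<zero>\<^bsub>A\<^esub>" "\<zero>\<^bsub>A\<^esub>"] f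
    by (metis A.zero_closed A.r_zero B.r_zero B.zero_closed B.add.l_cancel Pi_mem)
  show ?thesis
    using x
  proof (induction I rule: infinite_finite_induct)
    case (insert i I)
    then show ?case
      using f by (simp add: A.finsum_insert B.finsum_insert add A.finsum_closed Pi_def)
  qed (simp_all add: f_zero)
qed

section \<open>Change of coefficients in a group ring\<close>

lemma group_ring_iso_cong:
  assumes "ring S" "ring T" "group G" "finite (carrier G)" "S \<simeq> T"
  shows "group_ring S G \<simeq> group_ring T G"
proof -
  interpret S: group_ring_setup S G
    using assms by (simp add: group_ring_setup_def group_ring_setup_axioms_def)
  interpret T: group_ring_setup T G
    using assms by (simp add: group_ring_setup_def group_ring_setup_axioms_def)
  obtain h where h: "h \<in> ring_hom S T" and bij: "bij_betw h (carrier S) (carrier T)"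
    using assms(5) by (auto simp: is_ring_iso_def ring_iso_def)
  interpret h: ring_hom_ring S T h
    using h by unfold_locales (auto simp: ring_hom_ring_axioms_def)
  let ?H = "\<lambda>a. \<lambda>k\<in>carrier G. h (a k)"
  let ?h' = "inv_into (carrier S) h"
  have closed: "?H a \<in> carrier (group_ring T G)" if "a \<in> carrier (group_ring S G)" for a
    using that by (auto simp: group_ring_def PiE_iff)
  have h': "?h' y \<in> carrier S" "h (?h' y) = y" if "y \<in> carrier T" for y
    using bij that by (auto simp: bij_betw_def inv_into_into f_inv_into_f)
  have "?H \<in> ring_iso (group_ring S G) (group_ring T G)"
  proof (rule ring_iso_memI)
    fix a b assume a: "a \<in> carrier (group_ring S G)" and b: "b \<in> carrier (group_ring S G)"
    show "?H (a \<otimes>\<^bsub>group_ring S G\<^esub> b) = ?H a \<otimes>\<^bsub>group_ring T G\<^esub> ?H b"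
    proof (rule T.SG_eqI)
      fix k assume k: "k \<in> carrier G"
      have "?H (a \<otimes>\<^bsub>group_ring S G\<^esub> b) k
          = h (\<Oplus>\<^bsub>S\<^esub>g\<in>carrier G. a g \<otimes>\<^bsub>S\<^esub> b (inv\<^bsub>G\<^esub> g \<otimes>\<^bsub>G\<^esub> k))"
        using a b k by (simp add: S.SG_mult)
      also have "\<dots> = (\<Oplus>\<^bsub>T\<^esub>g\<in>carrier G. h (a g \<otimes>\<^bsub>S\<^esub> b (inv\<^bsub>G\<^esub> g \<otimes>\<^bsub>G\<^esub> k)))"
        using a b k by (intro additive_finsum) (auto intro: S.S.abelian_group_axioms T.S.abelian_group_axioms)
      also have "\<dots> = (\<Oplus>\<^bsub>T\<^esub>g\<in>carrier G. ?H a g \<otimes>\<^bsub>T\<^esub> ?H b (inv\<^bsub>G\<^esub> g \<otimes>\<^bsub>G\<^esub> k))"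
        using a b k by (intro T.S.finsum_cong') auto
      also have "\<dots> = (?H a \<otimes>\<^bsub>group_ring T G\<^esub> ?H b) k"
        using closed a b k by (simp only: T.SG_mult)
      finally show "?H (a \<otimes>\<^bsub>group_ring S G\<^esub> b) k = (?H a \<otimes>\<^bsub>group_ring T G\<^esub> ?H b) k" .
    qed (use a b in \<open>simp_all only: closed S.SG_mult_closed T.SG_mult_closed\<close>)
    show "?H (a \<oplus>\<^bsub>group_ring S G\<^esub> b) = ?H a \<oplus>\<^bsub>group_ring T G\<^esub> ?H b"
      using a b by (intro T.SG_eqI closed S.SG_add_closed T.SG_add_closed)
        (simp_all add: S.SG_add T.SG_add)
  next
    show "?H \<one>\<^bsub>group_ring S G\<^esub> = \<one>\<^bsub>group_ring T G\<^esub>"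
      by (intro T.SG_eqI closed S.SG_one_closed T.SG_one_closed) (simp add: S.SG_one T.SG_one)
  next
    show "bij_betw ?H (carrier (group_ring S G)) (carrier (group_ring T G))"
    proof (rule bij_betw_byWitness[where f' = "\<lambda>b. \<lambda>k\<in>carrier G. ?h' (b k)"])
      show "\<forall>a\<in>carrier (group_ring S G). (\<lambda>k\<in>carrier G. ?h' (?H a k)) = a"
        using bij by (auto intro!: S.SG_eqI simp: bij_betw_def group_ring_def PiE_iff)
      show "\<forall>b\<in>carrier (group_ring T G). ?H (\<lambda>k\<in>carrier G. ?h' (b k)) = b"
        using h' by (auto intro!: T.SG_eqI simp: group_ring_def PiE_iff)
    qed (use closed h' in \<open>auto simp: group_ring_def PiE_iff\<close>)
  qed (rule closed)
  then show ?thesis by (auto simp: is_ring_iso_def)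
qed

section \<open>Endomorphisms of a convolution module\<close>

text \<open>
  \<open>P\<close> is \<open>NG\<close>, with \<open>RG\<close> acting by convolution. It is a parameter, described only through its
  carrier, addition and scalar product: the module record also has a multiplication and a unit,
  which an endomorphism ring does not see.
\<close>

locale convolution_module =
  R: cring R + G: comm_group G + N: module R N + P: module "group_ring R G" P
  for R :: "('a, 'm) ring_scheme" and G :: "('g, 'k) monoid_scheme"
    and N :: "('a, 'v, 'x) module_scheme" and P :: "('g \<Rightarrow> 'a, 'g \<Rightarrow> 'v, 'y) module_scheme" +
  assumes finite_group: "finite (carrier G)"
    and carrier_P: "carrier P = carrier G \<rightarrow>\<^sub>E carrier N"
    and add_P: "\<And>Z Y k. Z \<in> carrier P \<Longrightarrow> Y \<in> carrier P \<Longrightarrow> k \<in> carrier G \<Longrightarrow>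
      (Z \<oplus>\<^bsub>P\<^esub> Y) k = Z k \<oplus>\<^bsub>N\<^esub> Y k"
    and smult_P: "\<And>a Z k. a \<in> carrier (group_ring R G) \<Longrightarrow> Z \<in> carrier P \<Longrightarrow> k \<in> carrier G \<Longrightarrow>
      (a \<odot>\<^bsub>P\<^esub> Z) k = (\<Oplus>\<^bsub>N\<^esub>g\<in>carrier G. a g \<odot>\<^bsub>N\<^esub> Z (inv\<^bsub>G\<^esub> g \<otimes>\<^bsub>G\<^esub> k))"
begin

abbreviation "E \<equiv> module_end_ring R N"
abbreviation "EG \<equiv> group_ring E G"

lemma E_ring: "ring E"
  by (rule N.module_end_ring_ring)

sublocale E: group_ring_setup E G
  using E_ring finite_group G.group_axioms
  by (simp add: group_ring_setup_def group_ring_setup_axioms_def)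

lemma P_at [simp, intro]: "Z \<in> carrier P \<Longrightarrow> k \<in> carrier G \<Longrightarrow> Z k \<in> carrier N"
  by (auto simp: carrier_P)

lemma P_eqI:
  "Z \<in> carrier P \<Longrightarrow> Y \<in> carrier P \<Longrightarrow> (\<And>k. k \<in> carrier G \<Longrightarrow> Z k = Y k) \<Longrightarrow> Z = Y"
  by (auto simp: carrier_P intro: PiE_ext)

lemma finsum_P:
  assumes "\<And>i. i \<in> I \<Longrightarrow> Z i \<in> carrier P" "k \<in> carrier G"
  shows "(\<Oplus>\<^bsub>P\<^esub>i\<in>I. Z i) k = (\<Oplus>\<^bsub>N\<^esub>i\<in>I. Z i k)"
  by (rule additive_finsum[where f = "\<lambda>Z. Z k"])
     (use assms in \<open>auto simp: add_P N.M.abelian_group_axioms P.M.abelian_group_axioms\<close>)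

lemma E_iff: "f \<in> carrier E \<longleftrightarrow> f \<in> carrier N \<rightarrow>\<^sub>E carrier N \<and>
    (\<forall>x\<in>carrier N. \<forall>y\<in>carrier N. f (x \<oplus>\<^bsub>N\<^esub> y) = f x \<oplus>\<^bsub>N\<^esub> f y) \<and>
    (\<forall>a\<in>carrier R. \<forall>x\<in>carrier N. f (a \<odot>\<^bsub>N\<^esub> x) = a \<odot>\<^bsub>N\<^esub> f x)"
  by (simp add: module_end_ring_def module_end_def)

lemma E_mem [simp, intro]: "f \<in> carrier E \<Longrightarrow> x \<in> carrier N \<Longrightarrow> f x \<in> carrier N"
  by (auto simp: E_iff)

lemma E_at:
  assumes "x \<in> carrier N"
  shows "(f \<oplus>\<^bsub>E\<^esub> g) x = f x \<oplus>\<^bsub>N\<^esub> g x" "(f \<otimes>\<^bsub>E\<^esub> g) x = f (g x)" "\<one>\<^bsub>E\<^esub> x = x" "\<zero>\<^bsub>E\<^esub> x = \<zero>\<^bsub>N\<^esub>"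
  using assms by (simp_all add: module_end_ring_def compose_def)

lemma E_finsum_at:
  assumes "\<And>i. i \<in> I \<Longrightarrow> f i \<in> carrier E" "x \<in> carrier N"
  shows "(\<Oplus>\<^bsub>E\<^esub>i\<in>I. f i) x = (\<Oplus>\<^bsub>N\<^esub>i\<in>I. f i x)"
  by (rule additive_finsum[where f = "\<lambda>f. f x"])
     (use assms in \<open>auto simp: E_at N.M.abelian_group_axioms E.S.abelian_group_axioms\<close>)

lemma E_finsum:
  assumes "f \<in> carrier E" "\<And>i. i \<in> I \<Longrightarrow> x i \<in> carrier N"
  shows "f (\<Oplus>\<^bsub>N\<^esub>i\<in>I. x i) = (\<Oplus>\<^bsub>N\<^esub>i\<in>I. f (x i))"
  by (rule additive_finsum) (use assms in \<open>auto simp: E_iff N.M.abelian_group_axioms\<close>)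

definition convolve :: "('g \<Rightarrow> 'v \<Rightarrow> 'v) \<Rightarrow> ('g \<Rightarrow> 'v) \<Rightarrow> 'g \<Rightarrow> 'v" where
  "convolve T = (\<lambda>Z\<in>carrier P. \<lambda>k\<in>carrier G.
     \<Oplus>\<^bsub>N\<^esub>g\<in>carrier G. T g (Z (inv\<^bsub>G\<^esub> g \<otimes>\<^bsub>G\<^esub> k)))"

lemma convolve_at:
  "Z \<in> carrier P \<Longrightarrow> k \<in> carrier G \<Longrightarrow>
    convolve T Z k = (\<Oplus>\<^bsub>N\<^esub>g\<in>carrier G. T g (Z (inv\<^bsub>G\<^esub> g \<otimes>\<^bsub>G\<^esub> k)))"
  by (simp add: convolve_def)

lemma convolve_closed:
  "T \<in> carrier EG \<Longrightarrow> Z \<in> carrier P \<Longrightarrow> convolve T Z \<in> carrier P"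
  unfolding convolve_def carrier_P by (auto simp: PiE_iff Pi_def intro!: N.M.finsum_closed E_mem)

lemma convolve_add:
  assumes T: "T \<in> carrier EG" and Z: "Z \<in> carrier P" and Y: "Y \<in> carrier P"
  shows "convolve T (Z \<oplus>\<^bsub>P\<^esub> Y) = convolve T Z \<oplus>\<^bsub>P\<^esub> convolve T Y"
proof (rule P_eqI)
  fix k assume k: "k \<in> carrier G"
  have "convolve T (Z \<oplus>\<^bsub>P\<^esub> Y) k
      = (\<Oplus>\<^bsub>N\<^esub>g\<in>carrier G. T g (Z (inv\<^bsub>G\<^esub> g \<otimes>\<^bsub>G\<^esub> k)) \<oplus>\<^bsub>N\<^esub> T g (Y (inv\<^bsub>G\<^esub> g \<otimes>\<^bsub>G\<^esub> k)))"
    unfolding convolve_at[OF P.M.a_closed[OF Z Y] k]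
  proof (rule N.M.finsum_cong')
    fix g assume g: "g \<in> carrier G"
    with T have "T g \<in> carrier E" by simp
    with Z Y g k show "T g ((Z \<oplus>\<^bsub>P\<^esub> Y) (inv\<^bsub>G\<^esub> g \<otimes>\<^bsub>G\<^esub> k))
        = T g (Z (inv\<^bsub>G\<^esub> g \<otimes>\<^bsub>G\<^esub> k)) \<oplus>\<^bsub>N\<^esub> T g (Y (inv\<^bsub>G\<^esub> g \<otimes>\<^bsub>G\<^esub> k))"
      by (simp add: add_P E_iff)
  qed (use T Z Y k in auto)
  also have "\<dots> = (convolve T Z \<oplus>\<^bsub>P\<^esub> convolve T Y) k"
    using T Z Y k by (simp add: add_P convolve_closed convolve_at N.M.finsum_addf Pi_def)
  finally show "convolve T (Z \<oplus>\<^bsub>P\<^esub> Y) k = (convolve T Z \<oplus>\<^bsub>P\<^esub> convolve T Y) k" .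
qed (use assms in \<open>simp_all add: convolve_closed\<close>)

text \<open>
  Both sides are double sums over the same terms, once \<open>h\<inverse>(g\<inverse>k) = g\<inverse>(h\<inverse>k)\<close>, which
  holds because \<open>G\<close> is abelian.
\<close>

lemma convolve_smult:
  assumes T: "T \<in> carrier EG" and a: "a \<in> carrier (group_ring R G)" and Z: "Z \<in> carrier P"
  shows "convolve T (a \<odot>\<^bsub>P\<^esub> Z) = a \<odot>\<^bsub>P\<^esub> convolve T Z"
proof (rule P_eqI)
  have a_at: "a g \<in> carrier R" if "g \<in> carrier G" for g
    using a that by (auto simp: group_ring_def)
  have aX: "a \<odot>\<^bsub>P\<^esub> Z \<in> carrier P" using a Z by simp
  fix k assume k: "k \<in> carrier G"
  let ?t = "\<lambda>g h. a h \<odot>\<^bsub>N\<^esub> T g (Z (inv\<^bsub>G\<^esub> g \<otimes>\<^bsub>G\<^esub> (inv\<^bsub>G\<^esub> h \<otimes>\<^bsub>G\<^esub> k)))"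
  have t: "?t g h \<in> carrier N" if "g \<in> carrier G" "h \<in> carrier G" for g h
    using that a_at T Z k by (auto intro!: E_mem)
  have "convolve T (a \<odot>\<^bsub>P\<^esub> Z) k = (\<Oplus>\<^bsub>N\<^esub>g\<in>carrier G. \<Oplus>\<^bsub>N\<^esub>h\<in>carrier G. ?t g h)"
    unfolding convolve_at[OF aX k]
  proof (rule N.M.finsum_cong')
    fix g assume g: "g \<in> carrier G"
    with T have Tg: "T g \<in> carrier E" by simp
    have "T g ((a \<odot>\<^bsub>P\<^esub> Z) (inv\<^bsub>G\<^esub> g \<otimes>\<^bsub>G\<^esub> k))
        = (\<Oplus>\<^bsub>N\<^esub>h\<in>carrier G. T g (a h \<odot>\<^bsub>N\<^esub> Z (inv\<^bsub>G\<^esub> h \<otimes>\<^bsub>G\<^esub> (inv\<^bsub>G\<^esub> g \<otimes>\<^bsub>G\<^esub> k))))"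
      using a a_at Z g k by (simp add: smult_P E_finsum[OF Tg])
    also have "\<dots> = (\<Oplus>\<^bsub>N\<^esub>h\<in>carrier G. ?t g h)"
    proof (rule N.M.finsum_cong')
      fix h assume h: "h \<in> carrier G"
      have "inv\<^bsub>G\<^esub> h \<otimes>\<^bsub>G\<^esub> (inv\<^bsub>G\<^esub> g \<otimes>\<^bsub>G\<^esub> k) = inv\<^bsub>G\<^esub> g \<otimes>\<^bsub>G\<^esub> (inv\<^bsub>G\<^esub> h \<otimes>\<^bsub>G\<^esub> k)"
        using g h k by (simp add: G.m_lcomm)
      then show "T g (a h \<odot>\<^bsub>N\<^esub> Z (inv\<^bsub>G\<^esub> h \<otimes>\<^bsub>G\<^esub> (inv\<^bsub>G\<^esub> g \<otimes>\<^bsub>G\<^esub> k))) = ?t g h"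
        using Tg a_at Z g h k by (simp add: E_iff)
    qed (use t g in auto)
    finally show "T g ((a \<odot>\<^bsub>P\<^esub> Z) (inv\<^bsub>G\<^esub> g \<otimes>\<^bsub>G\<^esub> k)) = (\<Oplus>\<^bsub>N\<^esub>h\<in>carrier G. ?t g h)" .
  qed (use t in \<open>auto intro!: N.M.finsum_closed\<close>)
  also have "\<dots> = (\<Oplus>\<^bsub>N\<^esub>h\<in>carrier G. \<Oplus>\<^bsub>N\<^esub>g\<in>carrier G. ?t g h)"
    by (rule N.M.finsum_swap) (use t finite_group in auto)
  also have "\<dots> = (\<Oplus>\<^bsub>N\<^esub>h\<in>carrier G. a h \<odot>\<^bsub>N\<^esub> convolve T Z (inv\<^bsub>G\<^esub> h \<otimes>\<^bsub>G\<^esub> k))"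
  proof (rule N.M.finsum_cong')
    fix h assume h: "h \<in> carrier G"
    show "(\<Oplus>\<^bsub>N\<^esub>g\<in>carrier G. ?t g h) = a h \<odot>\<^bsub>N\<^esub> convolve T Z (inv\<^bsub>G\<^esub> h \<otimes>\<^bsub>G\<^esub> k)"
      unfolding convolve_at[OF Z G.m_closed[OF G.inv_closed[OF h] k]]
      by (rule N.finsum_smult_ldistr[symmetric]) (use a_at h T Z k finite_group in \<open>auto intro!: E_mem\<close>)
  qed (use a_at T Z k convolve_closed in auto)
  also have "\<dots> = (a \<odot>\<^bsub>P\<^esub> convolve T Z) k"
    using a T Z k by (simp add: smult_P convolve_closed)
  finally show "convolve T (a \<odot>\<^bsub>P\<^esub> Z) k = (a \<odot>\<^bsub>P\<^esub> convolve T Z) k" .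
qed (use assms in \<open>simp_all add: convolve_closed\<close>)

lemma convolve_in_End: "T \<in> carrier EG \<Longrightarrow> convolve T \<in> module_end (group_ring R G) P"
  by (simp add: module_end_def PiE_iff convolve_add convolve_smult convolve_closed)
     (simp add: convolve_def)

text \<open>
  The argument is that for associativity of the group ring product: after exchanging the sums,
  the substitution \<open>m = gh\<close> turns one double sum into the other.
\<close>

lemma convolve_mult:
  assumes T: "T \<in> carrier EG" and U: "U \<in> carrier EG" and Z: "Z \<in> carrier P"
  shows "convolve (T \<otimes>\<^bsub>EG\<^esub> U) Z = convolve T (convolve U Z)"
proof (rule P_eqI)
  fix k assume k: "k \<in> carrier G"
  let ?t = "\<lambda>g m. T g (U (inv\<^bsub>G\<^esub> g \<otimes>\<^bsub>G\<^esub> m) (Z (inv\<^bsub>G\<^esub> m \<otimes>\<^bsub>G\<^esub> k)))"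
  have t: "?t g m \<in> carrier N" if "g \<in> carrier G" "m \<in> carrier G" for g m
    using that T U Z k by (auto intro!: E_mem)
  have "convolve (T \<otimes>\<^bsub>EG\<^esub> U) Z k = (\<Oplus>\<^bsub>N\<^esub>m\<in>carrier G. \<Oplus>\<^bsub>N\<^esub>g\<in>carrier G. ?t g m)"
    unfolding convolve_at[OF Z k]
  proof (rule N.M.finsum_cong')
    fix m assume m: "m \<in> carrier G"
    have "(T \<otimes>\<^bsub>EG\<^esub> U) m (Z (inv\<^bsub>G\<^esub> m \<otimes>\<^bsub>G\<^esub> k)) =
        (\<Oplus>\<^bsub>N\<^esub>g\<in>carrier G. (T g \<otimes>\<^bsub>E\<^esub> U (inv\<^bsub>G\<^esub> g \<otimes>\<^bsub>G\<^esub> m)) (Z (inv\<^bsub>G\<^esub> m \<otimes>\<^bsub>G\<^esub> k)))"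
      using T U Z m k by (simp add: E.SG_mult E_finsum_at)
    also have "\<dots> = (\<Oplus>\<^bsub>N\<^esub>g\<in>carrier G. ?t g m)"
      by (rule N.M.finsum_cong') (use t m Z k in \<open>auto simp: E_at\<close>)
    finally show "(T \<otimes>\<^bsub>EG\<^esub> U) m (Z (inv\<^bsub>G\<^esub> m \<otimes>\<^bsub>G\<^esub> k)) = (\<Oplus>\<^bsub>N\<^esub>g\<in>carrier G. ?t g m)" .
  qed (use t in \<open>auto intro!: N.M.finsum_closed\<close>)
  also have "\<dots> = (\<Oplus>\<^bsub>N\<^esub>g\<in>carrier G. \<Oplus>\<^bsub>N\<^esub>m\<in>carrier G. ?t g m)"
    by (rule N.M.finsum_swap) (use t finite_group in auto)
  also have "\<dots> = (\<Oplus>\<^bsub>N\<^esub>g\<in>carrier G. T g (convolve U Z (inv\<^bsub>G\<^esub> g \<otimes>\<^bsub>G\<^esub> k)))"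
  proof (rule N.M.finsum_cong')
    fix g assume g: "g \<in> carrier G"
    have "(\<Oplus>\<^bsub>N\<^esub>m\<in>carrier G. ?t g m) = (\<Oplus>\<^bsub>N\<^esub>m\<in>(\<lambda>h. g \<otimes>\<^bsub>G\<^esub> h) ` carrier G. ?t g m)"
      using g by (simp add: G.surj_const_mult)
    also have "\<dots> = (\<Oplus>\<^bsub>N\<^esub>h\<in>carrier G. ?t g (g \<otimes>\<^bsub>G\<^esub> h))"
      by (rule N.M.finsum_reindex) (use g t in \<open>auto simp: inj_on_def\<close>)
    also have "\<dots> = (\<Oplus>\<^bsub>N\<^esub>h\<in>carrier G. T g (U h (Z (inv\<^bsub>G\<^esub> h \<otimes>\<^bsub>G\<^esub> (inv\<^bsub>G\<^esub> g \<otimes>\<^bsub>G\<^esub> k)))))"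
      by (rule N.M.finsum_cong')
         (use g k T U Z in \<open>auto simp: G.m_assoc[symmetric] G.inv_mult_group intro!: E_mem\<close>)
    also have "\<dots> = T g (convolve U Z (inv\<^bsub>G\<^esub> g \<otimes>\<^bsub>G\<^esub> k))"
      unfolding convolve_at[OF Z G.m_closed[OF G.inv_closed[OF g] k]]
      by (rule E_finsum[symmetric]) (use g k T U Z in \<open>auto intro!: E_mem\<close>)
    finally show "(\<Oplus>\<^bsub>N\<^esub>m\<in>carrier G. ?t g m) = T g (convolve U Z (inv\<^bsub>G\<^esub> g \<otimes>\<^bsub>G\<^esub> k))" .
  qed (use T U Z k convolve_closed in \<open>auto intro!: E_mem\<close>)
  also have "\<dots> = convolve T (convolve U Z) k"
    using U Z k by (simp add: convolve_at convolve_closed)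
  finally show "convolve (T \<otimes>\<^bsub>EG\<^esub> U) Z k = convolve T (convolve U Z) k" .
qed (use assms in \<open>simp_all add: convolve_closed E.SG_mult_closed\<close>)

lemma convolve_plus:
  assumes T: "T \<in> carrier EG" and U: "U \<in> carrier EG" and Z: "Z \<in> carrier P"
  shows "convolve (T \<oplus>\<^bsub>EG\<^esub> U) Z = convolve T Z \<oplus>\<^bsub>P\<^esub> convolve U Z"
proof (rule P_eqI)
  fix k assume k: "k \<in> carrier G"
  have "convolve (T \<oplus>\<^bsub>EG\<^esub> U) Z k
      = (\<Oplus>\<^bsub>N\<^esub>g\<in>carrier G. T g (Z (inv\<^bsub>G\<^esub> g \<otimes>\<^bsub>G\<^esub> k)) \<oplus>\<^bsub>N\<^esub> U g (Z (inv\<^bsub>G\<^esub> g \<otimes>\<^bsub>G\<^esub> k)))"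
    unfolding convolve_at[OF Z k]
    by (rule N.M.finsum_cong') (use T U Z k in \<open>auto simp: E.SG_add E_at intro!: N.M.a_closed E_mem\<close>)
  also have "\<dots> = (convolve T Z \<oplus>\<^bsub>P\<^esub> convolve U Z) k"
    using T U Z k by (simp add: add_P convolve_closed convolve_at N.M.finsum_addf Pi_def)
  finally show "convolve (T \<oplus>\<^bsub>EG\<^esub> U) Z k = (convolve T Z \<oplus>\<^bsub>P\<^esub> convolve U Z) k" .
qed (use assms in \<open>simp_all add: convolve_closed E.SG_add_closed\<close>)

text \<open>The element \<open>v|1\<rangle>\<close> of \<open>NG\<close> and the scalar \<open>r|s\<rangle>\<close> of \<open>RG\<close>.\<close>

definition single :: "'v \<Rightarrow> 'g \<Rightarrow> 'v" where
  "single v = (\<lambda>k\<in>carrier G. if k = \<one>\<^bsub>G\<^esub> then v else \<zero>\<^bsub>N\<^esub>)"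

definition monomial :: "'g \<Rightarrow> 'a \<Rightarrow> 'g \<Rightarrow> 'a" where
  "monomial s r = (\<lambda>k\<in>carrier G. if k = s then r else \<zero>\<^bsub>R\<^esub>)"

lemma single_at: "k \<in> carrier G \<Longrightarrow> single v k = (if k = \<one>\<^bsub>G\<^esub> then v else \<zero>\<^bsub>N\<^esub>)"
  by (simp add: single_def)

lemma single_closed [simp]: "v \<in> carrier N \<Longrightarrow> single v \<in> carrier P"
  by (auto simp: single_def carrier_P)

lemma monomial_closed [simp]: "r \<in> carrier R \<Longrightarrow> monomial s r \<in> carrier (group_ring R G)"
  by (auto simp: monomial_def group_ring_def)

lemma inv_mult_eq_one_iff:
  "g \<in> carrier G \<Longrightarrow> k \<in> carrier G \<Longrightarrow> inv\<^bsub>G\<^esub> g \<otimes>\<^bsub>G\<^esub> k = \<one>\<^bsub>G\<^esub> \<longleftrightarrow> k = g"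
  by (metis G.inv_closed G.inv_equality G.inv_inv G.l_inv)

lemma monomial_smult:
  assumes s: "s \<in> carrier G" and r: "r \<in> carrier R" and Z: "Z \<in> carrier P" and k: "k \<in> carrier G"
  shows "(monomial s r \<odot>\<^bsub>P\<^esub> Z) k = r \<odot>\<^bsub>N\<^esub> Z (inv\<^bsub>G\<^esub> s \<otimes>\<^bsub>G\<^esub> k)"
proof -
  have "(monomial s r \<odot>\<^bsub>P\<^esub> Z) k
      = (\<Oplus>\<^bsub>N\<^esub>g\<in>carrier G. if s = g then r \<odot>\<^bsub>N\<^esub> Z (inv\<^bsub>G\<^esub> g \<otimes>\<^bsub>G\<^esub> k) else \<zero>\<^bsub>N\<^esub>)"
    unfolding smult_P[OF monomial_closed[OF r] Z k]
    by (rule N.M.finsum_cong') (use assms in \<open>auto simp: monomial_def N.smult_l_null\<close>)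
  also have "\<dots> = r \<odot>\<^bsub>N\<^esub> Z (inv\<^bsub>G\<^esub> s \<otimes>\<^bsub>G\<^esub> k)"
    by (rule N.M.finsum_singleton) (use assms finite_group in auto)
  finally show ?thesis .
qed

text \<open>This recovers \<open>T\<close> from its action, so the action is faithful.\<close>

lemma convolve_single:
  assumes T: "T \<in> carrier EG" and v: "v \<in> carrier N" and k: "k \<in> carrier G"
  shows "convolve T (single v) k = T k v"
proof -
  have T_zero: "T g \<zero>\<^bsub>N\<^esub> = \<zero>\<^bsub>N\<^esub>" if "g \<in> carrier G" for g
    using E_finsum[of "T g" "{}"] T that by simp
  have "convolve T (single v) k = (\<Oplus>\<^bsub>N\<^esub>g\<in>carrier G. if k = g then T g v else \<zero>\<^bsub>N\<^esub>)"
    unfolding convolve_at[OF single_closed[OF v] k]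
    by (rule N.M.finsum_cong')
       (use assms in \<open>auto simp: single_at inv_mult_eq_one_iff T_zero\<close>)
  also have "\<dots> = T k v"
    by (rule N.M.finsum_singleton) (use assms finite_group in auto)
  finally show ?thesis .
qed

text \<open>
  The elements \<open>v|1\<rangle>\<close> generate \<open>NG\<close> over \<open>RG\<close>, so an \<open>RG\<close>-linear map is determined by its values
  on them.
\<close>

lemma eq_finsum_shifted_single:
  assumes Z: "Z \<in> carrier P"
  shows "Z = (\<Oplus>\<^bsub>P\<^esub>s\<in>carrier G. monomial s \<one>\<^bsub>R\<^esub> \<odot>\<^bsub>P\<^esub> single (Z s))"
proof (rule P_eqI)
  fix k assume k: "k \<in> carrier G"
  have "(\<Oplus>\<^bsub>P\<^esub>s\<in>carrier G. monomial s \<one>\<^bsub>R\<^esub> \<odot>\<^bsub>P\<^esub> single (Z s)) k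
      = (\<Oplus>\<^bsub>N\<^esub>s\<in>carrier G. (monomial s \<one>\<^bsub>R\<^esub> \<odot>\<^bsub>P\<^esub> single (Z s)) k)"
    using Z k by (intro finsum_P) auto
  also have "\<dots> = (\<Oplus>\<^bsub>N\<^esub>s\<in>carrier G. if k = s then Z s else \<zero>\<^bsub>N\<^esub>)"
    by (rule N.M.finsum_cong')
       (use Z k in \<open>auto simp: monomial_smult single_at inv_mult_eq_one_iff\<close>)
  also have "\<dots> = Z k"
    by (rule N.M.finsum_singleton) (use Z k finite_group in auto)
  finally show "Z k = (\<Oplus>\<^bsub>P\<^esub>s\<in>carrier G. monomial s \<one>\<^bsub>R\<^esub> \<odot>\<^bsub>P\<^esub> single (Z s)) k" by simp
qed (use Z in \<open>auto intro!: P.M.finsum_closed\<close>)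

definition components :: "(('g \<Rightarrow> 'v) \<Rightarrow> 'g \<Rightarrow> 'v) \<Rightarrow> 'g \<Rightarrow> 'v \<Rightarrow> 'v" where
  "components \<phi> = (\<lambda>g\<in>carrier G. \<lambda>v\<in>carrier N. \<phi> (single v) g)"

text \<open>
  Scalar multiplication by \<open>r\<close> on \<open>N\<close> corresponds to the action of \<open>r|1\<rangle>\<close> on \<open>NG\<close>, which is how
  linearity over \<open>RG\<close> yields linearity of every component over \<open>R\<close>.
\<close>

lemma components_closed:
  assumes \<phi>: "\<phi> \<in> module_end (group_ring R G) P"
  shows "components \<phi> \<in> carrier EG"
proof -
  have mem: "\<phi> Z \<in> carrier P" if "Z \<in> carrier P" for Z
    using \<phi> that by (auto simp: module_end_def)
  have "(\<lambda>v\<in>carrier N. \<phi> (single v) g) \<in> carrier E" if g: "g \<in> carrier G" for g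
    unfolding E_iff
  proof (intro conjI ballI)
    fix v w assume v: "v \<in> carrier N" and w: "w \<in> carrier N"
    have "single (v \<oplus>\<^bsub>N\<^esub> w) = single v \<oplus>\<^bsub>P\<^esub> single w"
      by (rule P_eqI) (use v w in \<open>auto simp: add_P single_at\<close>)
    then show "(\<lambda>v\<in>carrier N. \<phi> (single v) g) (v \<oplus>\<^bsub>N\<^esub> w)
        = (\<lambda>v\<in>carrier N. \<phi> (single v) g) v \<oplus>\<^bsub>N\<^esub> (\<lambda>v\<in>carrier N. \<phi> (single v) g) w"
      using \<phi> v w g by (simp add: module_end_def add_P mem)
  next
    fix r v assume r: "r \<in> carrier R" and v: "v \<in> carrier N"
    have "single (r \<odot>\<^bsub>N\<^esub> v) = monomial \<one>\<^bsub>G\<^esub> r \<odot>\<^bsub>P\<^esub> single v"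
      by (rule P_eqI) (use r v in \<open>auto simp: monomial_smult single_at N.smult_r_null\<close>)
    then show "(\<lambda>v\<in>carrier N. \<phi> (single v) g) (r \<odot>\<^bsub>N\<^esub> v)
        = r \<odot>\<^bsub>N\<^esub> (\<lambda>v\<in>carrier N. \<phi> (single v) g) v"
      using \<phi> r v g by (simp add: module_end_def monomial_smult mem)
  qed (use g mem in auto)
  then show ?thesis by (simp add: group_ring_def components_def)
qed

text \<open>
  Applying \<open>\<phi>\<close> to the expansion of \<open>Z\<close> gives a sum over the position \<open>s\<close> in \<open>Z\<close>, whereas convolution
  sums over the shift \<open>g\<close>. The two are related by \<open>gs = k\<close>, that is by the involution
  \<open>g \<mapsto> g\<inverse>k\<close> of the abelian group \<open>G\<close>.
\<close>

lemma convolve_components: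
  assumes \<phi>: "\<phi> \<in> module_end (group_ring R G) P" and Z: "Z \<in> carrier P"
  shows "convolve (components \<phi>) Z = \<phi> Z"
proof (rule P_eqI)
  have mem: "\<phi> Z \<in> carrier P" if "Z \<in> carrier P" for Z
    using \<phi> that by (auto simp: module_end_def)
  show "\<phi> Z \<in> carrier P" using mem Z .
  show "convolve (components \<phi>) Z \<in> carrier P"
    using \<phi> Z by (simp add: convolve_closed components_closed)
  fix k assume k: "k \<in> carrier G"
  let ?i = "\<lambda>g. inv\<^bsub>G\<^esub> g \<otimes>\<^bsub>G\<^esub> k"
  have ii: "?i (?i g) = g" if "g \<in> carrier G" for g
    using that k by (simp add: G.inv_mult_group G.m_comm G.m_lcomm[of k])
  have inj: "inj_on ?i (carrier G)" using ii by (rule inj_on_inverseI)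
  have im: "?i ` carrier G = carrier G"
    using ii k by (auto simp: image_iff) (metis G.inv_closed G.m_closed)
  have "\<phi> Z = \<phi> (\<Oplus>\<^bsub>P\<^esub>s\<in>carrier G. monomial s \<one>\<^bsub>R\<^esub> \<odot>\<^bsub>P\<^esub> single (Z s))"
    using eq_finsum_shifted_single[OF Z] by simp
  also have "\<dots> = (\<Oplus>\<^bsub>P\<^esub>s\<in>carrier G. \<phi> (monomial s \<one>\<^bsub>R\<^esub> \<odot>\<^bsub>P\<^esub> single (Z s)))"
    by (rule additive_finsum[where f = \<phi>])
       (use \<phi> Z in \<open>auto simp: module_end_def P.M.abelian_group_axioms\<close>)
  finally have "\<phi> Z k = (\<Oplus>\<^bsub>P\<^esub>s\<in>carrier G. \<phi> (monomial s \<one>\<^bsub>R\<^esub> \<odot>\<^bsub>P\<^esub> single (Z s))) k"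
    by (rule fun_cong)
  also have "\<dots> = (\<Oplus>\<^bsub>N\<^esub>s\<in>carrier G. \<phi> (monomial s \<one>\<^bsub>R\<^esub> \<odot>\<^bsub>P\<^esub> single (Z s)) k)"
    by (rule finsum_P) (use mem Z k in auto)
  also have "\<dots> = (\<Oplus>\<^bsub>N\<^esub>s\<in>?i ` carrier G. \<phi> (single (Z s)) (?i s))"
    unfolding im
  proof (rule N.M.finsum_cong')
    fix s assume s: "s \<in> carrier G"
    have "\<phi> (monomial s \<one>\<^bsub>R\<^esub> \<odot>\<^bsub>P\<^esub> single (Z s)) = monomial s \<one>\<^bsub>R\<^esub> \<odot>\<^bsub>P\<^esub> \<phi> (single (Z s))"
      using \<phi> Z s by (simp add: module_end_def)
    then show "\<phi> (monomial s \<one>\<^bsub>R\<^esub> \<odot>\<^bsub>P\<^esub> single (Z s)) k = \<phi> (single (Z s)) (?i s)"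
      using Z s k mem by (simp add: monomial_smult)
  qed (use mem Z k in auto)
  also have "\<dots> = (\<Oplus>\<^bsub>N\<^esub>g\<in>carrier G. \<phi> (single (Z (?i g))) (?i (?i g)))"
    by (rule N.M.finsum_reindex[OF _ inj]) (use mem Z k in auto)
  also have "\<dots> = (\<Oplus>\<^bsub>N\<^esub>g\<in>carrier G. components \<phi> g (Z (?i g)))"
    by (rule N.M.finsum_cong') (use mem Z k ii in \<open>auto simp: components_def\<close>)
  also have "\<dots> = convolve (components \<phi>) Z k"
    using Z k by (simp add: convolve_at)
  finally show "convolve (components \<phi>) Z k = \<phi> Z k" by simp
qed

theorem group_ring_End_iso: "EG \<simeq> module_end_ring (group_ring R G) P"
proof -
  let ?M = "module_end_ring (group_ring R G) P"
  have carrier: "carrier ?M = module_end (group_ring R G) P"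
    by (simp add: module_end_ring_def)
  have ext: "f = g" if "f \<in> extensional (carrier P)" "g \<in> extensional (carrier P)"
      "\<And>Z. Z \<in> carrier P \<Longrightarrow> f Z = g Z" for f g :: "('g \<Rightarrow> 'v) \<Rightarrow> 'g \<Rightarrow> 'v"
    using that by (rule extensionalityI)
  have convolve_ext: "convolve T \<in> extensional (carrier P)" for T
    by (simp add: convolve_def)
  have M_at: "(f \<otimes>\<^bsub>?M\<^esub> g) Z = f (g Z)"
    "(f \<oplus>\<^bsub>?M\<^esub> g) Z = f Z \<oplus>\<^bsub>P\<^esub> g Z" 
    if "Z \<in> carrier P" for f g Z
    using that by (simp_all add: module_end_ring_def compose_def)
  have M_ext: "f \<otimes>\<^bsub>?M\<^esub> g \<in> extensional (carrier P)" "f \<oplus>\<^bsub>?M\<^esub> g \<in> extensional (carrier P)" for f g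
    by (simp_all add: module_end_ring_def compose_def)
  have one: "convolve \<one>\<^bsub>EG\<^esub> = \<one>\<^bsub>?M\<^esub>"
  proof (rule ext)
    fix Z assume Z: "Z \<in> carrier P"
    have "convolve \<one>\<^bsub>EG\<^esub> Z = Z"
    proof (rule P_eqI)
      fix k assume k: "k \<in> carrier G"
      have "convolve \<one>\<^bsub>EG\<^esub> Z k
          = (\<Oplus>\<^bsub>N\<^esub>g\<in>carrier G. if \<one>\<^bsub>G\<^esub> = g then Z (inv\<^bsub>G\<^esub> g \<otimes>\<^bsub>G\<^esub> k) else \<zero>\<^bsub>N\<^esub>)"
        unfolding convolve_at[OF Z k]
        by (rule N.M.finsum_cong') (use Z k in \<open>auto simp: E.SG_one E_at\<close>)
      also have "\<dots> = Z (inv\<^bsub>G\<^esub> \<one>\<^bsub>G\<^esub> \<otimes>\<^bsub>G\<^esub> k)"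
        by (rule N.M.finsum_singleton) (use Z k finite_group in auto)
      finally show "convolve \<one>\<^bsub>EG\<^esub> Z k = Z k"
        using Z k by simp
    qed (use Z in \<open>simp_all add: convolve_closed E.SG_one_closed\<close>)
    with Z show "convolve \<one>\<^bsub>EG\<^esub> Z = \<one>\<^bsub>?M\<^esub> Z"
      by (simp add: module_end_ring_def)
  qed (simp_all add: convolve_ext, simp add: module_end_ring_def)
  have "convolve \<in> ring_iso EG ?M"
  proof (rule ring_iso_memI)
    fix T U assume TU: "T \<in> carrier EG" "U \<in> carrier EG"
    show "convolve (T \<otimes>\<^bsub>EG\<^esub> U) = convolve T \<otimes>\<^bsub>?M\<^esub> convolve U"
      by (rule ext[OF convolve_ext M_ext(1)]) (use TU in \<open>simp add: convolve_mult M_at\<close>)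
    show "convolve (T \<oplus>\<^bsub>EG\<^esub> U) = convolve T \<oplus>\<^bsub>?M\<^esub> convolve U"
      by (rule ext[OF convolve_ext M_ext(2)]) (use TU in \<open>simp add: convolve_plus M_at\<close>)
  next
    show "bij_betw convolve (carrier EG) (carrier ?M)"
    proof (rule bij_betw_byWitness[where f' = components])
      show "\<forall>T\<in>carrier EG. components (convolve T) = T"
      proof
        fix T assume T: "T \<in> carrier EG"
        show "components (convolve T) = T"
        proof (rule E.SG_eqI)
          fix g assume g: "g \<in> carrier G"
          then have "T g \<in> extensional (carrier N)" using T E_iff[of "T g"] by (auto simp: PiE_iff)
          then show "components (convolve T) g = T g"
            by (intro extensionalityI[of _ "carrier N"])
               (use T g in \<open>auto simp: components_def convolve_single\<close>)
        qed (use T in \<open>simp_all add: components_closed convolve_in_End\<close>)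
      qed
      show "\<forall>\<phi>\<in>carrier ?M. convolve (components \<phi>) = \<phi>"
        by (auto intro!: ext simp: convolve_ext convolve_components carrier)
           (auto simp: module_end_def PiE_iff)
    qed (auto simp: carrier convolve_in_End components_closed)
  qed (simp_all add: one carrier convolve_in_End)
  then show ?thesis by (auto simp: is_ring_iso_def)
qed

end

section \<open>Matrices as endomorphisms of a free module\<close>

text \<open>
  The module operations live in a record that extends rings, whose multiplication and unit are
  left unspecified here.
\<close>

definition free_module :: "('a, 'm) ring_scheme \<Rightarrow> 'i set \<Rightarrow> ('a, 'i \<Rightarrow> 'a) module" where
  "free_module R I = \<lparr>
     carrier = I \<rightarrow>\<^sub>E carrier R,
     monoid.mult = (\<lambda>v w. undefined),
     one = undefined,
     ring.zero = (\<lambda>i\<in>I. \<zero>\<^bsub>R\<^esub>),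
     add = (\<lambda>v w. \<lambda>i\<in>I. v i \<oplus>\<^bsub>R\<^esub> w i),
     smult = (\<lambda>r v. \<lambda>i\<in>I. r \<otimes>\<^bsub>R\<^esub> v i)\<rparr>"

lemma free_module_simps:
  "carrier (free_module R I) = I \<rightarrow>\<^sub>E carrier R"
  "\<zero>\<^bsub>free_module R I\<^esub> = (\<lambda>i\<in>I. \<zero>\<^bsub>R\<^esub>)"
  "v \<oplus>\<^bsub>free_module R I\<^esub> w = (\<lambda>i\<in>I. v i \<oplus>\<^bsub>R\<^esub> w i)"
  "r \<odot>\<^bsub>free_module R I\<^esub> v = (\<lambda>i\<in>I. r \<otimes>\<^bsub>R\<^esub> v i)"
  by (simp_all add: free_module_def)

lemma free_module_module:
  assumes "cring R"
  shows "module R (free_module R I)"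
proof -
  interpret R: cring R by fact
  let ?N = "free_module R I"
  have eqI: "v = w" if "v \<in> I \<rightarrow>\<^sub>E carrier R" "w \<in> I \<rightarrow>\<^sub>E carrier R" "\<And>i. i \<in> I \<Longrightarrow> v i = w i"
    for v w using that by (rule PiE_ext)
  have "abelian_group ?N"
  proof (rule abelian_groupI)
    fix v assume v: "v \<in> carrier ?N"
    then show "\<exists>w\<in>carrier ?N. w \<oplus>\<^bsub>?N\<^esub> v = \<zero>\<^bsub>?N\<^esub>"
      by (intro bexI[of _ "\<lambda>i\<in>I. \<ominus>\<^bsub>R\<^esub> v i"])
         (auto simp: free_module_simps PiE_iff R.l_neg fun_eq_iff)
  qed (auto intro!: eqI intro: extensional_arb simp: free_module_simps PiE_iff R.a_ac)
  with \<open>cring R\<close> show ?thesis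
    by (rule moduleI)
       (auto intro!: eqI intro: extensional_arb simp: free_module_simps PiE_iff R.l_distr R.r_distr R.m_assoc)
qed

lemma finsum_free_module:
  assumes "cring R" "\<And>x. x \<in> A \<Longrightarrow> v x \<in> I \<rightarrow>\<^sub>E carrier R" "i \<in> I"
  shows "(\<Oplus>\<^bsub>free_module R I\<^esub>x\<in>A. v x) i = (\<Oplus>\<^bsub>R\<^esub>x\<in>A. v x i)"
proof -
  interpret R: cring R by fact
  interpret N: module R "free_module R I" by (rule free_module_module) fact
  show ?thesis
    by (rule additive_finsum[where f = "\<lambda>v. v i"])
       (use assms in \<open>auto simp: free_module_simps N.M.abelian_group_axioms R.abelian_group_axioms\<close>)
qed

text \<open>
  After a choice of enumeration \<open>e\<close> of the basis this is the usual correspondence between matrices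
  and linear maps. Scalars and matrix entries both multiply coordinates from the left, so the
  maps are linear because \<open>R\<close> is commutative.
\<close>

lemma matrix_ring_iso_End:
  fixes R :: "('a, 'm) ring_scheme" and I :: "'i set"
  assumes "cring R" "finite I"
  shows "matrix_ring (card I) R \<simeq> module_end_ring R (free_module R I)"
proof -
  interpret R: cring R by fact
  let ?n = "card I" and ?N = "free_module R I"
  interpret N: module R ?N by (rule free_module_module) fact
  let ?M = "matrix_ring ?n R" and ?E = "module_end_ring R ?N"
  obtain e where e: "bij_betw e {..<?n} I"
    using ex_bij_betw_nat_finite[OF \<open>finite I\<close>] by (auto simp: atLeast0LessThan)
  have e_in [simp]: "e i \<in> I" if "i < ?n" for i
    using e that by (auto simp: bij_betw_def)
  have e_eq: "e i = e j \<longleftrightarrow> i = j" if "i < ?n" "j < ?n" for i j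
    using e that by (auto simp: bij_betw_def inj_on_def)
  have N_eqI: "v = w" if "v \<in> carrier ?N" "w \<in> carrier ?N" "\<And>i. i < ?n \<Longrightarrow> v (e i) = w (e i)"
    for v w
  proof (rule PiE_ext[of v I "\<lambda>_. carrier R"])
    fix t assume "t \<in> I"
    then obtain i where "i < ?n" "t = e i" using e by (auto simp: bij_betw_def)
    then show "v t = w t" using that by simp
  qed (use that in \<open>simp_all add: free_module_simps\<close>)
  have N_at [simp]: "v (e i) \<in> carrier R" if "v \<in> carrier ?N" "i < ?n" for v i
    using that by (auto simp: free_module_simps)
  have M_at [simp]: "A (i, j) \<in> carrier R" if "A \<in> carrier ?M" "i < ?n" "j < ?n" for A i j
    using that by (auto simp: matrix_ring_def)
  have M_eqI: "A = B" if "A \<in> carrier ?M" "B \<in> carrier ?M"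
    "\<And>i j. i < ?n \<Longrightarrow> j < ?n \<Longrightarrow> A (i, j) = B (i, j)" for A B
    using that unfolding matrix_ring_def
    by (intro PiE_ext[of A "{..<?n} \<times> {..<?n}" "\<lambda>_. carrier R" B]) auto
  interpret M: ring ?M by (rule matrix_ring_ring) unfold_locales
  have E_carrier: "carrier ?E = module_end R ?N" by (simp add: module_end_ring_def)
  have E_eqI: "f = g" if "f \<in> extensional (carrier ?N)" "g \<in> extensional (carrier ?N)"
    "\<And>v. v \<in> carrier ?N \<Longrightarrow> f v = g v" for f g :: "('i \<Rightarrow> 'a) \<Rightarrow> 'i \<Rightarrow> 'a"
    using that by (rule extensionalityI)
  define mv where "mv A = (\<lambda>v\<in>carrier ?N. \<lambda>t\<in>I.
      \<Oplus>\<^bsub>R\<^esub>j\<in>{..<?n}. A (inv_into {..<?n} e t, j) \<otimes>\<^bsub>R\<^esub> v (e j))" for A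
  have mv_ext: "mv A \<in> extensional (carrier ?N)" for A by (simp add: mv_def)
  have mv_at: "mv A v (e i) = (\<Oplus>\<^bsub>R\<^esub>j\<in>{..<?n}. A (i, j) \<otimes>\<^bsub>R\<^esub> v (e j))"
    if "v \<in> carrier ?N" "i < ?n" for A v i
    using that e by (simp add: mv_def bij_betw_def)
  have inv_e: "inv_into {..<?n} e t < ?n" if "t \<in> I" for t
    using e that by (metis bij_betw_def inv_into_into lessThan_iff)
  have mv_closed [simp]: "mv A v \<in> carrier ?N" if "A \<in> carrier ?M" "v \<in> carrier ?N" for A v
    using that inv_e by (auto simp: mv_def free_module_simps(1)[of R I] intro!: R.finsum_closed R.m_closed)
  have mv_End: "mv A \<in> carrier ?E" if A: "A \<in> carrier ?M" for A
  proof -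
    have "mv A (v \<oplus>\<^bsub>?N\<^esub> w) = mv A v \<oplus>\<^bsub>?N\<^esub> mv A w" if vw: "v \<in> carrier ?N" "w \<in> carrier ?N" for v w
    proof (rule N_eqI)
      fix i assume i: "i < ?n"
      have "mv A (v \<oplus>\<^bsub>?N\<^esub> w) (e i)
          = (\<Oplus>\<^bsub>R\<^esub>j\<in>{..<?n}. A (i, j) \<otimes>\<^bsub>R\<^esub> v (e j) \<oplus>\<^bsub>R\<^esub> A (i, j) \<otimes>\<^bsub>R\<^esub> w (e j))"
        unfolding mv_at[OF N.M.a_closed[OF vw] i]
        by (rule R.finsum_cong') (use A vw i in \<open>auto simp: free_module_simps(3) R.r_distr\<close>)
      then show "mv A (v \<oplus>\<^bsub>?N\<^esub> w) (e i) = (mv A v \<oplus>\<^bsub>?N\<^esub> mv A w) (e i)"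
        using A vw i by (simp add: free_module_simps(3) mv_at R.finsum_addf Pi_def)
    qed (use A vw in simp_all)
    moreover have "mv A (r \<odot>\<^bsub>?N\<^esub> v) = r \<odot>\<^bsub>?N\<^esub> mv A v"
      if r: "r \<in> carrier R" and v: "v \<in> carrier ?N" for r v
    proof (rule N_eqI)
      fix i assume i: "i < ?n"
      have "mv A (r \<odot>\<^bsub>?N\<^esub> v) (e i) = (\<Oplus>\<^bsub>R\<^esub>j\<in>{..<?n}. r \<otimes>\<^bsub>R\<^esub> (A (i, j) \<otimes>\<^bsub>R\<^esub> v (e j)))"
        unfolding mv_at[OF N.smult_closed[OF r v] i]
        by (rule R.finsum_cong') (use A r v i in \<open>auto simp: free_module_simps(4) R.m_lcomm\<close>)
      then show "mv A (r \<odot>\<^bsub>?N\<^esub> v) (e i) = (r \<odot>\<^bsub>?N\<^esub> mv A v) (e i)"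
        using A r v i by (simp add: free_module_simps(4) mv_at R.finsum_rdistr Pi_def)
    qed (use A r v in simp_all)
    ultimately show ?thesis
      using A mv_ext by (simp add: E_carrier module_end_def PiE_iff)
  qed
  \<comment> \<open>The standard basis vectors, indexed by numbers through \<open>e\<close>.\<close>
  define b where "b j = (\<lambda>t\<in>I. if t = e j then \<one>\<^bsub>R\<^esub> else \<zero>\<^bsub>R\<^esub>)" for j
  have b [simp]: "b j \<in> carrier ?N" for j by (auto simp: b_def free_module_simps)
  have b_at: "b j (e i) = (if j = i then \<one>\<^bsub>R\<^esub> else \<zero>\<^bsub>R\<^esub>)" if "i < ?n" "j < ?n" for i j
    using that by (auto simp: b_def e_eq)
  have expand: "v = (\<Oplus>\<^bsub>?N\<^esub>j\<in>{..<?n}. v (e j) \<odot>\<^bsub>?N\<^esub> b j)" if v: "v \<in> carrier ?N" for v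
  proof (rule N_eqI)
    fix i assume i: "i < ?n"
    have "(\<Oplus>\<^bsub>?N\<^esub>j\<in>{..<?n}. v (e j) \<odot>\<^bsub>?N\<^esub> b j) (e i) = (\<Oplus>\<^bsub>R\<^esub>j\<in>{..<?n}. (v (e j) \<odot>\<^bsub>?N\<^esub> b j) (e i))"
      by (rule finsum_free_module)
         (use v i \<open>cring R\<close> in \<open>auto simp: free_module_simps(1)[symmetric]\<close>)
    also have "\<dots> = (\<Oplus>\<^bsub>R\<^esub>j\<in>{..<?n}. if i = j then v (e j) else \<zero>\<^bsub>R\<^esub>)"
      by (rule R.finsum_cong') (use v i in \<open>auto simp: free_module_simps(4) b_at\<close>)
    also have "\<dots> = v (e i)"
      by (rule R.finsum_singleton) (use v i in auto)
    finally show "v (e i) = (\<Oplus>\<^bsub>?N\<^esub>j\<in>{..<?n}. v (e j) \<odot>\<^bsub>?N\<^esub> b j) (e i)" by simp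
  qed (use v in \<open>auto intro!: N.M.finsum_closed\<close>)
  have mv_b: "mv A (b j) (e i) = A (i, j)" if "A \<in> carrier ?M" "i < ?n" "j < ?n" for A i j
  proof -
    have "mv A (b j) (e i) = (\<Oplus>\<^bsub>R\<^esub>l\<in>{..<?n}. if j = l then A (i, l) else \<zero>\<^bsub>R\<^esub>)"
      unfolding mv_at[OF b that(2)]
      by (rule R.finsum_cong') (use that in \<open>auto simp: b_at\<close>)
    also have "\<dots> = A (i, j)"
      by (rule R.finsum_singleton) (use that in auto)
    finally show ?thesis .
  qed
  define mat where "mat \<phi> = (\<lambda>(i, j)\<in>{..<?n} \<times> {..<?n}. \<phi> (b j) (e i))" for \<phi> :: "('i \<Rightarrow> 'a) \<Rightarrow> 'i \<Rightarrow> 'a"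
  have mat_closed: "mat \<phi> \<in> carrier ?M" if "\<phi> \<in> carrier ?E" for \<phi>
    using that by (auto simp: mat_def matrix_ring_def E_carrier module_end_def intro!: N_at)
  have mv_mat: "mv (mat \<phi>) = \<phi>" if \<phi>: "\<phi> \<in> carrier ?E" for \<phi>
  proof (rule E_eqI[OF mv_ext])
    show "\<phi> \<in> extensional (carrier ?N)"
      using \<phi> by (simp add: E_carrier module_end_def PiE_iff)
    have mem [simp]: "\<phi> v \<in> carrier ?N" if "v \<in> carrier ?N" for v
      using \<phi> that by (auto simp: E_carrier module_end_def)
    fix v assume v: "v \<in> carrier ?N"
    show "mv (mat \<phi>) v = \<phi> v"
    proof (rule N_eqI)
      fix i assume i: "i < ?n"
      have "\<phi> v = \<phi> (\<Oplus>\<^bsub>?N\<^esub>j\<in>{..<?n}. v (e j) \<odot>\<^bsub>?N\<^esub> b j)"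
        using expand[OF v] by simp
      also have "\<dots> = (\<Oplus>\<^bsub>?N\<^esub>j\<in>{..<?n}. \<phi> (v (e j) \<odot>\<^bsub>?N\<^esub> b j))"
        by (rule additive_finsum[where f = \<phi>])
           (use \<phi> v in \<open>auto simp: E_carrier module_end_def N.M.abelian_group_axioms\<close>)
      finally have "\<phi> v (e i) = (\<Oplus>\<^bsub>?N\<^esub>j\<in>{..<?n}. \<phi> (v (e j) \<odot>\<^bsub>?N\<^esub> b j)) (e i)"
        by (rule fun_cong)
      also have "\<dots> = (\<Oplus>\<^bsub>R\<^esub>j\<in>{..<?n}. \<phi> (v (e j) \<odot>\<^bsub>?N\<^esub> b j) (e i))"
        by (rule finsum_free_module)
           (use v i \<open>cring R\<close> in \<open>auto simp: free_module_simps(1)[symmetric]\<close>)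
      also have "\<dots> = (\<Oplus>\<^bsub>R\<^esub>j\<in>{..<?n}. mat \<phi> (i, j) \<otimes>\<^bsub>R\<^esub> v (e j))"
      proof (rule R.finsum_cong')
        fix j assume j: "j \<in> {..<?n}"
        have "\<phi> (v (e j) \<odot>\<^bsub>?N\<^esub> b j) = v (e j) \<odot>\<^bsub>?N\<^esub> \<phi> (b j)"
          using \<phi> v j by (simp add: E_carrier module_end_def)
        then show "\<phi> (v (e j) \<odot>\<^bsub>?N\<^esub> b j) (e i) = mat \<phi> (i, j) \<otimes>\<^bsub>R\<^esub> v (e j)"
          using v i j by (simp add: free_module_simps(4) mat_def R.m_comm)
      qed (use mat_closed[OF \<phi>] v i in auto)
      finally show "mv (mat \<phi>) v (e i) = \<phi> v (e i)"
        using v i by (simp add: mv_at)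
    qed (use v mat_closed[OF \<phi>] in simp_all)
  qed
  have mv_mult: "mv (A \<otimes>\<^bsub>?M\<^esub> B) v = mv A (mv B v)"
    if A: "A \<in> carrier ?M" and B: "B \<in> carrier ?M" and v: "v \<in> carrier ?N" for A B v
  proof (rule N_eqI)
    fix i assume i: "i < ?n"
    let ?t = "\<lambda>j l. A (i, l) \<otimes>\<^bsub>R\<^esub> (B (l, j) \<otimes>\<^bsub>R\<^esub> v (e j))"
    have t: "?t j l \<in> carrier R" if "j < ?n" "l < ?n" for j l
      using that A B v i by simp
    have "mv (A \<otimes>\<^bsub>?M\<^esub> B) v (e i) = (\<Oplus>\<^bsub>R\<^esub>j\<in>{..<?n}. \<Oplus>\<^bsub>R\<^esub>l\<in>{..<?n}. ?t j l)"
      unfolding mv_at[OF v i]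
    proof (rule R.finsum_cong')
      fix j assume j: "j \<in> {..<?n}"
      have "(A \<otimes>\<^bsub>?M\<^esub> B) (i, j) \<otimes>\<^bsub>R\<^esub> v (e j) = (\<Oplus>\<^bsub>R\<^esub>l\<in>{..<?n}. A (i, l) \<otimes>\<^bsub>R\<^esub> B (l, j) \<otimes>\<^bsub>R\<^esub> v (e j))"
        using A B v i j by (simp add: matrix_ring_def[of ?n R] R.finsum_ldistr Pi_def
            M_at[unfolded matrix_ring_def])
      also have "\<dots> = (\<Oplus>\<^bsub>R\<^esub>l\<in>{..<?n}. ?t j l)"
        by (rule R.finsum_cong') (use A B v i j in \<open>auto simp: R.m_assoc\<close>)
      finally show "(A \<otimes>\<^bsub>?M\<^esub> B) (i, j) \<otimes>\<^bsub>R\<^esub> v (e j) = (\<Oplus>\<^bsub>R\<^esub>l\<in>{..<?n}. ?t j l)" .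
    qed (use t in \<open>auto intro!: R.finsum_closed\<close>)
    also have "\<dots> = (\<Oplus>\<^bsub>R\<^esub>l\<in>{..<?n}. \<Oplus>\<^bsub>R\<^esub>j\<in>{..<?n}. ?t j l)"
      by (rule R.finsum_swap) (use t in auto)
    also have "\<dots> = (\<Oplus>\<^bsub>R\<^esub>l\<in>{..<?n}. A (i, l) \<otimes>\<^bsub>R\<^esub> mv B v (e l))"
      by (rule R.finsum_cong') (use A B v i in \<open>auto simp: mv_at R.finsum_rdistr Pi_def\<close>)
    also have "\<dots> = mv A (mv B v) (e i)"
      using B v i by (simp add: mv_at)
    finally show "mv (A \<otimes>\<^bsub>?M\<^esub> B) v (e i) = mv A (mv B v) (e i)" .
  qed (use A B v in simp_all)
  have mv_add: "mv (A \<oplus>\<^bsub>?M\<^esub> B) v = mv A v \<oplus>\<^bsub>?N\<^esub> mv B v"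
    if A: "A \<in> carrier ?M" and B: "B \<in> carrier ?M" and v: "v \<in> carrier ?N" for A B v
  proof (rule N_eqI)
    fix i assume i: "i < ?n"
    have "mv (A \<oplus>\<^bsub>?M\<^esub> B) v (e i)
        = (\<Oplus>\<^bsub>R\<^esub>j\<in>{..<?n}. A (i, j) \<otimes>\<^bsub>R\<^esub> v (e j) \<oplus>\<^bsub>R\<^esub> B (i, j) \<otimes>\<^bsub>R\<^esub> v (e j))"
      unfolding mv_at[OF v i]
    proof (rule R.finsum_cong')
      fix j assume j: "j \<in> {..<?n}"
      have "(A \<oplus>\<^bsub>?M\<^esub> B) (i, j) = A (i, j) \<oplus>\<^bsub>R\<^esub> B (i, j)"
        using i j by (simp add: matrix_ring_def)
      then show "(A \<oplus>\<^bsub>?M\<^esub> B) (i, j) \<otimes>\<^bsub>R\<^esub> v (e j)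
          = A (i, j) \<otimes>\<^bsub>R\<^esub> v (e j) \<oplus>\<^bsub>R\<^esub> B (i, j) \<otimes>\<^bsub>R\<^esub> v (e j)"
        using A B v i j by (simp add: R.l_distr)
    qed (use A B v i in auto)
    then show "mv (A \<oplus>\<^bsub>?M\<^esub> B) v (e i) = (mv A v \<oplus>\<^bsub>?N\<^esub> mv B v) (e i)"
      using A B v i by (simp add: free_module_simps(3) mv_at R.finsum_addf Pi_def)
  qed (use A B v in simp_all)
  have mv_one: "mv \<one>\<^bsub>?M\<^esub> v = v" if v: "v \<in> carrier ?N" for v
  proof (rule N_eqI)
    fix i assume i: "i < ?n"
    have "mv \<one>\<^bsub>?M\<^esub> v (e i) = (\<Oplus>\<^bsub>R\<^esub>j\<in>{..<?n}. if i = j then v (e j) else \<zero>\<^bsub>R\<^esub>)"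
      unfolding mv_at[OF v i]
      by (rule R.finsum_cong') (use v i in \<open>auto simp: matrix_ring_def\<close>)
    also have "\<dots> = v (e i)"
      by (rule R.finsum_singleton) (use v i in auto)
    finally show "mv \<one>\<^bsub>?M\<^esub> v (e i) = v (e i)" .
  qed (use v in simp_all)
  have "mv \<in> ring_iso ?M ?E"
  proof (rule ring_iso_memI)
    fix A B assume AB: "A \<in> carrier ?M" "B \<in> carrier ?M"
    show "mv (A \<otimes>\<^bsub>?M\<^esub> B) = mv A \<otimes>\<^bsub>?E\<^esub> mv B"
      by (rule E_eqI[OF mv_ext])
         (use AB in \<open>simp_all add: mv_mult module_end_ring_def compose_def\<close>)
    show "mv (A \<oplus>\<^bsub>?M\<^esub> B) = mv A \<oplus>\<^bsub>?E\<^esub> mv B"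
      by (rule E_eqI[OF mv_ext]) (use AB in \<open>simp_all add: mv_add module_end_ring_def\<close>)
  next
    show "mv \<one>\<^bsub>?M\<^esub> = \<one>\<^bsub>?E\<^esub>"
      by (rule E_eqI[OF mv_ext]) (simp_all add: mv_one module_end_ring_def)
    show "bij_betw mv (carrier ?M) (carrier ?E)"
    proof (rule bij_betw_byWitness[where f' = mat])
      show "\<forall>A\<in>carrier ?M. mat (mv A) = A"
        using mv_End by (auto intro!: M_eqI mat_closed) (simp add: mat_def mv_b)
    qed (use mv_mat mv_End mat_closed in auto)
  qed (rule mv_End)
  then show ?thesis by (auto simp: is_ring_iso_def)
qed

section \<open>The module over the group ring\<close>

text \<open>
  The scalar product embeds each coefficient of the scalar into \<open>RG\<close> and multiplies there. Since
  multiplication by an embedded coefficient is coefficientwise scaling, this is convolution with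
  values in the free \<open>R\<close>-module underlying \<open>RG\<close>.
\<close>

lemma group_ring_module_convolution:
  assumes "cring R" "comm_group G" "finite (carrier G)"
  shows "convolution_module R G (free_module R (carrier G)) (group_ring_module R G)"
proof -
  interpret R: cring R by fact
  interpret G: comm_group G by fact
  interpret V: group_ring_setup R G by unfold_locales fact
  let ?V = "group_ring R G" and ?N = "free_module R (carrier G)" and ?P = "group_ring_module R G"
  interpret VR: ring ?V by (rule V.SG_ring)
  interpret N: module R ?N by (rule free_module_module) fact
  interpret P: module ?V ?P by (rule group_ring_module_module) fact+
  have N_V: "carrier ?N = carrier ?V"
    by (simp add: free_module_simps group_ring_def)
  have P_carrier: "carrier ?P = carrier G \<rightarrow>\<^sub>E carrier ?V"
    by (simp add: group_ring_module_simps group_ring_def[of ?V])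
  show ?thesis
  proof (unfold_locales)
    fix Z Y k assume "k \<in> carrier G"
    then show "(Z \<oplus>\<^bsub>?P\<^esub> Y) k = Z k \<oplus>\<^bsub>?N\<^esub> Y k"
      by (simp add: group_ring_module_simps group_ring_def free_module_simps)
  next
    fix a Z k assume a: "a \<in> carrier ?V" and Z: "Z \<in> carrier ?P" and k: "k \<in> carrier G"
    let ?Q = "{(r, s). r \<in> carrier G \<and> s \<in> carrier G \<and> r \<otimes>\<^bsub>G\<^esub> s = k}"
    let ?i = "\<lambda>g. (g, inv\<^bsub>G\<^esub> g \<otimes>\<^bsub>G\<^esub> k)"
    have Z_at: "Z g \<in> carrier ?V" if "g \<in> carrier G" for g
      using Z that by (auto simp: P_carrier)
    have embed_mult: "group_ring_embed R G (a g) \<otimes>\<^bsub>?V\<^esub> Z h = a g \<odot>\<^bsub>?N\<^esub> Z h"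
      if "g \<in> carrier G" "h \<in> carrier G" for g h
      by (rule V.SG_eqI)
         (use that a Z_at V.SG_embed_closed V.SG_mult_closed N.smult_closed[of "a g" "Z h"] in
            \<open>auto simp: N_V V.SG_embed_mult, simp add: free_module_simps\<close>)
    have Q: "?Q = ?i ` carrier G"
      using k G.inv_solve_left' by (auto simp: G.m_assoc[symmetric] image_iff)
    have "(a \<odot>\<^bsub>?P\<^esub> Z) k = finsum ?V (\<lambda>(r, s). group_ring_embed R G (a r) \<otimes>\<^bsub>?V\<^esub> Z s) (?i ` carrier G)"
      using k by (simp add: group_ring_module_def ring.defs module.defs Q)
    also have "\<dots> = (\<Oplus>\<^bsub>?V\<^esub>g\<in>carrier G.
        (\<lambda>(r, s). group_ring_embed R G (a r) \<otimes>\<^bsub>?V\<^esub> Z s) (?i g))"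
      by (rule VR.finsum_reindex) (use a Z_at k V.SG_embed_closed in \<open>auto simp: inj_on_def\<close>)
    also have "\<dots> = (\<Oplus>\<^bsub>?V\<^esub>g\<in>carrier G. a g \<odot>\<^bsub>?N\<^esub> Z (inv\<^bsub>G\<^esub> g \<otimes>\<^bsub>G\<^esub> k))"
      by (rule VR.finsum_cong')
         (use a Z_at k embed_mult N.smult_closed in \<open>auto simp: N_V\<close>)
    also have "\<dots> = (\<Oplus>\<^bsub>?N\<^esub>g\<in>carrier G. a g \<odot>\<^bsub>?N\<^esub> Z (inv\<^bsub>G\<^esub> g \<otimes>\<^bsub>G\<^esub> k))"
      by (rule additive_finsum[where f = "\<lambda>v. v"])
         (use a Z_at k N.smult_closed in \<open>auto simp: N_V VR.abelian_group_axioms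
            N.M.abelian_group_axioms, simp add: group_ring_def free_module_simps\<close>)
    finally show "(a \<odot>\<^bsub>?P\<^esub> Z) k = (\<Oplus>\<^bsub>?N\<^esub>g\<in>carrier G. a g \<odot>\<^bsub>?N\<^esub> Z (inv\<^bsub>G\<^esub> g \<otimes>\<^bsub>G\<^esub> k))" .
  qed (use assms in \<open>simp_all add: P_carrier N_V\<close>)
qed

theorem theorem5:
  fixes R :: "('a, 'm) ring_scheme" and G :: "('g, 'k) monoid_scheme" and n :: nat
  assumes "cring R"
    and "comm_group G"
    and "finite (carrier G)"
    and "order G = n"
  shows "group_ring (matrix_ring n R) G
           \<simeq> module_end_ring (group_ring R G) (group_ring_module R G)"
proof -
  interpret R: cring R by fact
  interpret G: comm_group G by fact
  let ?N = "free_module R (carrier G)"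
  interpret convolution_module R G ?N "group_ring_module R G"
    by (rule group_ring_module_convolution) fact+
  have "matrix_ring n R \<simeq> module_end_ring R ?N"
    using matrix_ring_iso_End[OF assms(1,3)] assms(4) by (simp add: order_def)
  then have "group_ring (matrix_ring n R) G \<simeq> group_ring (module_end_ring R ?N) G"
    by (intro group_ring_iso_cong matrix_ring_ring E_ring)
       (use assms(3) in \<open>simp_all add: R.ring_axioms G.group_axioms\<close>)
  then show ?thesis
    using group_ring_End_iso by (rule ring_iso_trans)
qed

end
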